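(* Let $G=(V,E)$ be a finite, undirected, simple, connected graph and consider the concurrent SCPR game on $G$ (described in the context) with a fixed robber strategy $\sigma_3$. Define $\mathbf{v}^{(0)}$ by $v^{(0)}(\tau)=0$ and $v^{(0)}(s)=q(s)$ for all $s\in\widehat{\mathbf{S}}_a$, and for $i=1,2,\dots$ define $\mathbf{v}^{(i)}$ by $v^{(i)}(\tau)=0$ and \[ \forall s=(x^1,x^2,x^3)\in\widehat{\mathbf{S}}_a:\quad v^{(i)}(s)=\mathbf{Val}\Big[q(s)+\sum_{s'\in\widehat{\mathbf{S}}}\Pr(s'\mid s,a^1,a^2)\,v^{(i-1)}(s')\Big], \] where $\mathbf{Val}$ is the value of the matrix game in which $C_1$ chooses $a^1\in N[x^1]$, $C_2$ chooses $a^2\in N[x^2]$ and $C_1$ receives the bracketed quantity. Then for every $s\in\widehat{\mathbf{S}}_a$, $\lim_{i\to\infty}v^{(i)}(s)$ exists and equals $v(s)$, the value of the concurrent SCPR game played on $G$ starting from $s$.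
   Context: $N[x]$ denotes the closed neighbourhood of a vertex $x$. The concurrent Selfish Cops and Passive Robber (SCPR) game on $G$: two cop players $C_1,C_2$ each move a token, and a robber token $R$ is moved by chance; in every turn all three tokens move simultaneously. State space: $\widehat{\mathbf{S}}_a=V\times V\times V$ and $\widehat{\mathbf{S}}=\widehat{\mathbf{S}}_a\cup\{\tau\}$ with $\tau$ terminal; $(x^1,x^2,x^3)$ means $C_1,C_2,R$ are at $x^1,x^2,x^3$. It is a $C_1$-capture state if $x^1=x^3$ and a $C_2$-capture state if $x^2=x^3$ and $x^1\ne x^3$. The robber moves according to a fixed, known, stationary Markovian (possibly randomized) strategy $\sigma_3$, $\sigma_3(\cdot\mid s)$ a distribution on $N[x^3]$. Transitions: from a capture state or from $\tau$ the next state is $\tau$ with probability 1. From a non-capture state $s=(x^1,x^2,x^3)$, simultaneously $C_1$ chooses $a^1\in N[x^1]$, $C_2$ chooses $a^2\in N[x^2]$ and the robber's move $a^3$ is drawn from $\sigma_3(\cdot\mid s)$; the next state is $(a^1,a^2,a^3)$, except that if for some $i\in\{1,2\}$, $a^i=x^3$ and $a^3=x^i$ (en-passant capture), the next state is $(a^1,a^2,x^3)$. $\Pr(s'\mid s,a^1,a^2)$ denotes the resulting transition probability. Strategies for $C_i$ are arbitrary history-dependent, possibly randomized, rules choosing legal actions. Immediate payoff: $q(s)=1$ if $s$ is a $C_1$-capture state, else $0$ ($q(\tau)=0$). $J(\sigma_1,\sigma_2\mid s_0)=\mathbb{E}[\sum_{t\ge0}q(s_t)]$ is $C_1$'s expected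 payoff ($C_2$ receives $-J$); the value $v(s_0)$ is the common value of $\sup_{\sigma_1}\inf_{\sigma_2}J(\sigma_1,\sigma_2\mid s_0)$ and $\inf_{\sigma_2}\sup_{\sigma_1}J(\sigma_1,\sigma_2\mid s_0)$ (which exists for all $s_0\in\widehat{\mathbf{S}}_a$). *)

theory Defs
  imports "HOL-Probability.Probability" "Graph_Theory.Digraph_Component"
begin

text \<open>
  Values of zero-sum games. Suprema and infima are taken in the extended reals, so that
  no boundedness side condition is hidden in them.
\<close>

definition has_value :: "'x set \<Rightarrow> 'y set \<Rightarrow> ('x \<Rightarrow> 'y \<Rightarrow> real) \<Rightarrow> real \<Rightarrow> bool" where
  "has_value X Y f w \<longleftrightarrow>
     (SUP x\<in>X. INF y\<in>Y. ereal (f x y)) = ereal w \<and>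
     (INF y\<in>Y. SUP x\<in>X. ereal (f x y)) = ereal w"

definition mixed :: "'a set \<Rightarrow> 'a pmf set" where
  "mixed A = {p. set_pmf p \<subseteq> A}"

definition matrix_Val :: "'a set \<Rightarrow> 'b set \<Rightarrow> ('a \<Rightarrow> 'b \<Rightarrow> real) \<Rightarrow> real" where
  "matrix_Val A B f =
     (THE w. has_value (mixed A) (mixed B) (\<lambda>p r. \<Sum>a\<in>A. \<Sum>b\<in>B. pmf p a * pmf r b * f a b) w)"

text \<open>
  Graphs are symmetric digraphs, as usual in the graph library; \<open>graph G\<close> says that \<open>G\<close> is
  finite, loop-free and without multiple edges.
\<close>

definition closed_nbhd :: "('a, 'b) pre_digraph \<Rightarrow> 'a \<Rightarrow> 'a set" where
  "closed_nbhd G x = insert x {y. x \<rightarrow>\<^bsub>G\<^esub> y}"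

datatype 'a state = Tokens 'a 'a 'a | Terminal

definition active_states :: "('a, 'b) pre_digraph \<Rightarrow> 'a state set" where
  "active_states G = {Tokens x1 x2 x3 | x1 x2 x3. x1 \<in> verts G \<and> x2 \<in> verts G \<and> x3 \<in> verts G}"

definition states :: "('a, 'b) pre_digraph \<Rightarrow> 'a state set" where
  "states G = insert Terminal (active_states G)"

fun C1_capture :: "'a state \<Rightarrow> bool" where
  "C1_capture (Tokens x1 x2 x3) \<longleftrightarrow> x1 = x3"
| "C1_capture Terminal \<longleftrightarrow> False"

fun C2_capture :: "'a state \<Rightarrow> bool" where
  "C2_capture (Tokens x1 x2 x3) \<longleftrightarrow> x2 = x3 \<and> x1 \<noteq> x3"
| "C2_capture Terminal \<longleftrightarrow> False"

definition payoff :: "'a state \<Rightarrow> real" where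
  "payoff s = (if C1_capture s then 1 else 0)"

definition robber_strategy :: "('a, 'b) pre_digraph \<Rightarrow> ('a state \<Rightarrow> 'a pmf) \<Rightarrow> bool" where
  "robber_strategy G \<sigma>3 \<longleftrightarrow>
     (\<forall>x1 x2 x3. Tokens x1 x2 x3 \<in> active_states G \<longrightarrow>
        set_pmf (\<sigma>3 (Tokens x1 x2 x3)) \<subseteq> closed_nbhd G x3)"

text \<open>The inner conditional implements en-passant capture.\<close>

fun transition :: "('a state \<Rightarrow> 'a pmf) \<Rightarrow> 'a state \<Rightarrow> 'a \<Rightarrow> 'a \<Rightarrow> 'a state pmf" where
  "transition \<sigma>3 (Tokens x1 x2 x3) a1 a2 =
     (if C1_capture (Tokens x1 x2 x3) \<or> C2_capture (Tokens x1 x2 x3) then return_pmf Terminal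
      else map_pmf
        (\<lambda>a3. if a1 = x3 \<and> a3 = x1 \<or> a2 = x3 \<and> a3 = x2 then Tokens a1 a2 x3 else Tokens a1 a2 a3)
        (\<sigma>3 (Tokens x1 x2 x3)))"
| "transition \<sigma>3 Terminal a1 a2 = return_pmf Terminal"

text \<open>
  A history is the list of all states visited so far, in chronological order, with the current
  state last. It determines the relevant past actions of both cops, as these are recorded in
  the successor state of every non-capture state. Actions at \<open>Terminal\<close> have no effect and are
  left unconstrained.
\<close>

type_synonym 'a strategy = "'a state list \<Rightarrow> 'a pmf"

definition C1_strategies :: "('a, 'b) pre_digraph \<Rightarrow> 'a strategy set" where
  "C1_strategies G =
     {\<sigma>. \<forall>h x1 x2 x3. set (h @ [Tokens x1 x2 x3]) \<subseteq> states G \<longrightarrow>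
           set_pmf (\<sigma> (h @ [Tokens x1 x2 x3])) \<subseteq> closed_nbhd G x1}"

definition C2_strategies :: "('a, 'b) pre_digraph \<Rightarrow> 'a strategy set" where
  "C2_strategies G =
     {\<sigma>. \<forall>h x1 x2 x3. set (h @ [Tokens x1 x2 x3]) \<subseteq> states G \<longrightarrow>
           set_pmf (\<sigma> (h @ [Tokens x1 x2 x3])) \<subseteq> closed_nbhd G x2}"

definition step ::
  "('a state \<Rightarrow> 'a pmf) \<Rightarrow> 'a strategy \<Rightarrow> 'a strategy \<Rightarrow> 'a state list \<Rightarrow> 'a state pmf" where
  "step \<sigma>3 \<sigma>1 \<sigma>2 h =
     bind_pmf (\<sigma>1 h) (\<lambda>a1. bind_pmf (\<sigma>2 h) (\<lambda>a2. transition \<sigma>3 (last h) a1 a2))"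

text \<open>
  The law of the play \<open>(s\<^sub>0, s\<^sub>1, \<dots>)\<close> on the sequence space over \<open>states G\<close> is given by the
  Ionescu-Tulcea theorem: \<open>play_kernel\<close> is the conditional law of \<open>s\<^sub>n\<close> given \<open>s\<^sub>0, \<dots>, s\<^sub>n\<^sub>-\<^sub>1\<close>.
\<close>

definition play_kernel ::
  "('a, 'b) pre_digraph \<Rightarrow> ('a state \<Rightarrow> 'a pmf) \<Rightarrow> 'a strategy \<Rightarrow> 'a strategy \<Rightarrow> 'a state \<Rightarrow>
     nat \<Rightarrow> (nat \<Rightarrow> 'a state) \<Rightarrow> 'a state measure" where
  "play_kernel G \<sigma>3 \<sigma>1 \<sigma>2 s0 n \<omega> =
     restrict_space
       (measure_pmf (if n = 0 then return_pmf s0 else step \<sigma>3 \<sigma>1 \<sigma>2 (map \<omega> [0..<n])))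
       (states G)"

definition play_measure ::
  "('a, 'b) pre_digraph \<Rightarrow> ('a state \<Rightarrow> 'a pmf) \<Rightarrow> 'a strategy \<Rightarrow> 'a strategy \<Rightarrow> 'a state \<Rightarrow>
     (nat \<Rightarrow> 'a state) measure" where
  "play_measure G \<sigma>3 \<sigma>1 \<sigma>2 s0 =
     projective_family.lim UNIV
       (Ionescu_Tulcea.CI (play_kernel G \<sigma>3 \<sigma>1 \<sigma>2 s0) (\<lambda>_. count_space (states G)))
       (\<lambda>_. count_space (states G))"

definition expected_payoff ::
  "('a, 'b) pre_digraph \<Rightarrow> ('a state \<Rightarrow> 'a pmf) \<Rightarrow> 'a strategy \<Rightarrow> 'a strategy \<Rightarrow> 'a state \<Rightarrow> real" where
  "expected_payoff G \<sigma>3 \<sigma>1 \<sigma>2 s0 = (\<integral>\<omega>. (\<Sum>t. payoff (\<omega> t)) \<partial>play_measure G \<sigma>3 \<sigma>1 \<sigma>2 s0)"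

definition SCPR_has_value ::
  "('a, 'b) pre_digraph \<Rightarrow> ('a state \<Rightarrow> 'a pmf) \<Rightarrow> 'a state \<Rightarrow> real \<Rightarrow> bool" where
  "SCPR_has_value G \<sigma>3 s0 w \<longleftrightarrow>
     has_value (C1_strategies G) (C2_strategies G) (\<lambda>\<sigma>1 \<sigma>2. expected_payoff G \<sigma>3 \<sigma>1 \<sigma>2 s0) w"

primrec value_iter ::
  "('a, 'b) pre_digraph \<Rightarrow> ('a state \<Rightarrow> 'a pmf) \<Rightarrow> nat \<Rightarrow> 'a state \<Rightarrow> real" where
  "value_iter G \<sigma>3 0 s = (case s of Terminal \<Rightarrow> 0 | Tokens x1 x2 x3 \<Rightarrow> payoff s)"
| "value_iter G \<sigma>3 (Suc i) s =
     (case s of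
        Terminal \<Rightarrow> 0
      | Tokens x1 x2 x3 \<Rightarrow>
          matrix_Val (closed_nbhd G x1) (closed_nbhd G x2)
            (\<lambda>a1 a2. payoff s +
               (\<Sum>s'\<in>states G. pmf (transition \<sigma>3 s a1 a2) s' * value_iter G \<sigma>3 i s')))"

lemma finite_states: "finite (verts G) \<Longrightarrow> finite (states G)"
proof -
  assume "finite (verts G)"
  moreover have "active_states G =
      (\<lambda>(x, y, z). Tokens x y z) ` (verts G \<times> verts G \<times> verts G)"
    by (auto simp: active_states_def image_iff)
  ultimately show ?thesis
    by (simp add: states_def)
qed

lemma closed_nbhd_subset: "wf_digraph G \<Longrightarrow> x \<in> verts G \<Longrightarrow> closed_nbhd G x \<subseteq> verts G"
  by (auto simp: closed_nbhd_def arcs_ends_conv wf_digraph_def)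

lemma set_pmf_step_subset:
  assumes G: "wf_digraph G" and R: "robber_strategy G \<sigma>3"
    and 1: "\<sigma>1 \<in> C1_strategies G" and 2: "\<sigma>2 \<in> C2_strategies G"
    and h: "h \<noteq> []" "set h \<subseteq> states G"
  shows "set_pmf (step \<sigma>3 \<sigma>1 \<sigma>2 h) \<subseteq> states G"
proof (cases "last h")
  case Terminal
  then show ?thesis by (auto simp: step_def states_def)
next
  case (Tokens x1 x2 x3)
  then have h': "h = butlast h @ [Tokens x1 x2 x3]"
    using h by (metis append_butlast_last_id)
  have s: "Tokens x1 x2 x3 \<in> active_states G"
    using h Tokens last_in_set[OF h(1)] by (auto simp: states_def)
  then have x: "x1 \<in> verts G" "x2 \<in> verts G" "x3 \<in> verts G"
    by (auto simp: active_states_def)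
  have "set_pmf (\<sigma>1 h) \<subseteq> closed_nbhd G x1"
    using 1 h(2) h' unfolding C1_strategies_def by (metis (mono_tags, lifting) mem_Collect_eq)
  moreover have "set_pmf (\<sigma>2 h) \<subseteq> closed_nbhd G x2"
    using 2 h(2) h' unfolding C2_strategies_def by (metis (mono_tags, lifting) mem_Collect_eq)
  moreover have "set_pmf (\<sigma>3 (Tokens x1 x2 x3)) \<subseteq> closed_nbhd G x3"
    using R s by (auto simp: robber_strategy_def)
  ultimately have "set_pmf (\<sigma>1 h) \<subseteq> verts G" "set_pmf (\<sigma>2 h) \<subseteq> verts G"
    "set_pmf (\<sigma>3 (Tokens x1 x2 x3)) \<subseteq> verts G"
    using closed_nbhd_subset[OF G] x by blast+
  then show ?thesis
    using x by (auto simp: step_def Tokens states_def active_states_def subset_iff split: if_splits)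
qed

lemma Ionescu_Tulcea_play_kernel:
  assumes G: "wf_digraph G" "finite (verts G)" and R: "robber_strategy G \<sigma>3"
    and 1: "\<sigma>1 \<in> C1_strategies G" and 2: "\<sigma>2 \<in> C2_strategies G" and s0: "s0 \<in> states G"
  shows "Ionescu_Tulcea (play_kernel G \<sigma>3 \<sigma>1 \<sigma>2 s0) (\<lambda>_. count_space (states G))"
proof (rule Ionescu_Tulcea.intro)
  let ?M = "\<lambda>_::nat. count_space (states G)"
  have M: "PiM {0..<i} ?M = count_space (PiE {0..<i} (\<lambda>_. states G))" for i
    by (rule count_space_PiM_finite) (simp_all add: finite_states G countable_finite)
  have prob: "prob_space (play_kernel G \<sigma>3 \<sigma>1 \<sigma>2 s0 i x)" if "x \<in> space (PiM {0..<i} ?M)" for i x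
  proof -
    define p where "p = (if i = 0 then return_pmf s0 else step \<sigma>3 \<sigma>1 \<sigma>2 (map x [0..<i]))"
    have "set_pmf p \<subseteq> states G"
    proof (cases "i = 0")
      case False
      have "set (map x [0..<i]) \<subseteq> states G"
        using that by (auto simp: M PiE_iff)
      then show ?thesis
        using set_pmf_step_subset[OF G(1) R 1 2] False by (simp add: p_def)
    qed (use s0 in \<open>simp add: p_def\<close>)
    then have "emeasure (measure_pmf p) (states G) = 1"
      by (intro measure_pmf.emeasure_eq_1_AE) (auto simp: AE_measure_pmf_iff)
    then have "prob_space (restrict_space (measure_pmf p) (states G))"
      by (intro prob_spaceI) (simp add: space_restrict_space emeasure_restrict_space)
    then show ?thesis by (simp add: play_kernel_def p_def)
  qed
  show "prob_space (play_kernel G \<sigma>3 \<sigma>1 \<sigma>2 s0 i x)" if "x \<in> space (PiM {0..<i} ?M)" for i x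
    using that by (rule prob)
  have "sets (play_kernel G \<sigma>3 \<sigma>1 \<sigma>2 s0 i x) = Pow (states G)" for i x
    by (auto simp: play_kernel_def sets_restrict_space)
  then show "play_kernel G \<sigma>3 \<sigma>1 \<sigma>2 s0 i \<in> PiM {0..<i} ?M \<rightarrow>\<^sub>M subprob_algebra (?M i)" for i
    using prob[of _ i] unfolding M
    by (auto simp: space_subprob_algebra prob_space_imp_subprob_space)
qed

end

theory Submission
  imports Defs
begin

text \<open>
  The iterates increase and are bounded by \<open>1\<close>, hence they converge, and since \<open>Val\<close> is
  nonexpansive the limit \<open>v\<close> is a fixed point of the Shapley operator. If \<open>C\<^sub>2\<close> plays in every
  state an optimal mixed action of the matrix game with continuation payoff \<open>v\<close>, then
  \<open>\<Sum>\<^sub>t\<^sub><\<^sub>n q(s\<^sub>t) + v(s\<^sub>n)\<close> is a supermartingale, so that \<open>J \<le> v(s\<^sub>0)\<close> because \<open>v \<ge> 0\<close>.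
  If \<open>C\<^sub>1\<close> plays optimally in the game truncated after \<open>N\<close> steps, then
  \<open>\<Sum>\<^sub>t\<^sub><\<^sub>n q(s\<^sub>t) + v\<^bsup>(N-n)\<^esup>(s\<^sub>n)\<close> is a submartingale up to time \<open>N\<close>, where \<open>v\<^bsup>(0)\<^esup> = q\<close>
  makes it a partial sum of the payoffs, so that \<open>J \<ge> v\<^bsup>(N)\<^esup>(s\<^sub>0)\<close>.
\<close>

section \<open>Values of matrix games\<close>

lemma has_value_unique: "has_value X Y f w \<Longrightarrow> has_value X Y f w' \<Longrightarrow> w = w'"
  by (simp add: has_value_def)

text \<open>The premises are asymmetric because truncation gives C1 only guarantees arbitrarily
  close to the value, whereas C2 has an exactly optimal strategy. They bound the lower value from
  below and the upper value from above, and the lower value never exceeds the upper one.\<close>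

lemma has_valueI:
  assumes lower: "\<And>c. c < w \<Longrightarrow> \<exists>x\<in>X. \<forall>y\<in>Y. c \<le> f x y"
    and y: "y \<in> Y" "\<And>x. x \<in> X \<Longrightarrow> f x y \<le> w"
  shows "has_value X Y f w"
proof -
  have 1: "ereal w \<le> (SUP x\<in>X. INF y\<in>Y. ereal (f x y))"
  proof (rule dense_le)
    show "z \<le> (SUP x\<in>X. INF y\<in>Y. ereal (f x y))" if z: "z < ereal w" for z
    proof -
      obtain c where c: "z < ereal c" "c < w" using ereal_dense2[OF z] by auto
      then obtain x where "x \<in> X" "\<forall>y\<in>Y. c \<le> f x y" using lower by blast
      with c(1) show ?thesis
        by (intro SUP_upper2[of x] INF_greatest) (auto intro: order_trans[OF less_imp_le])
    qed
  qed
  have 2: "(SUP x\<in>X. INF y\<in>Y. ereal (f x y)) \<le> (INF y\<in>Y. SUP x\<in>X. ereal (f x y))"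
    by (intro SUP_least INF_greatest) (meson INF_lower SUP_upper order_trans)
  have 3: "(INF y\<in>Y. SUP x\<in>X. ereal (f x y)) \<le> ereal w"
    using y by (intro INF_lower2[of y] SUP_least) auto
  show ?thesis
    using 1 2 3 by (auto simp: has_value_def)
qed

text \<open>A line with normal \<open>a\<close> and level \<open>b\<close> separates
  \<open>S\<close> from the open quadrant. The quadrant is unbounded in both directions, which makes
  both coordinates of \<open>a\<close> nonnegative, and it has its corner at the origin, which gives
  \<open>b \<le> 0\<close>. Since \<open>a\<close> is nonzero, it can be scaled to total weight
  one.\<close>

lemma convex_avoids_positive_quadrant:
  fixes S :: "(real \<times> real) set"
  assumes "convex S" and avoid: "\<And>x. x \<in> S \<Longrightarrow> 0 < fst x \<Longrightarrow> 0 < snd x \<Longrightarrow> False"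
  shows "\<exists>s t. 0 \<le> s \<and> 0 \<le> t \<and> s + t = 1 \<and> (\<forall>x\<in>S. s * fst x + t * snd x \<le> 0)"
proof (cases "S = {}")
  case True
  then show ?thesis by (intro exI[of _ 1] exI[of _ 0]) simp
next
  case False
  let ?T = "{0<..} \<times> {0<..} :: (real \<times> real) set"
  have "convex ?T" by (intro convex_Times convex_real_interval)
  moreover have "(1, 1) \<in> ?T" by simp
  then have "?T \<noteq> {}" by blast
  moreover have "S \<inter> ?T = {}" using avoid by fastforce
  ultimately obtain a b where ab: "a \<noteq> 0" "\<And>x. x \<in> S \<Longrightarrow> inner a x \<le> b" "\<And>x. x \<in> ?T \<Longrightarrow> b \<le> inner a x"
    using separating_hyperplane_sets[OF \<open>convex S\<close> _ False] by metis
  obtain a1 a2 where a: "a = (a1, a2)" by fastforce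
  have b: "b \<le> a1 * x + a2 * y" if "0 < x" "0 < y" for x y
    using ab(3)[of "(x, y)"] that by (simp add: a)
  \<comment> \<open>Along the diagonal the functional tends to 0 at the origin, so its lower bound
    \<open>b\<close> is at most 0.\<close>
  have lim: "((\<lambda>x. a1 * x + a2 * x) \<longlongrightarrow> a1 * 0 + a2 * 0) (at_right 0)"
    by (intro tendsto_intros)
  have "b \<le> 0"
    using tendsto_lowerbound[OF lim, of b] b by (simp add: eventually_at_filter trivial_limit_at_right_real)
  have "0 \<le> a1"
  proof (rule ccontr)
    assume n: "\<not> 0 \<le> a1"
    \<comment> \<open>The first coordinate is chosen so that the first product is minus (|a2| + |b|
      + 1); adding \<open>a2\<close> leaves a number below \<open>b\<close>.\<close>
    have "b \<le> a1 * ((\<bar>a2\<bar> + \<bar>b\<bar> + 1) / - a1) + a2 * 1"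
      using n by (intro b divide_pos_pos) auto
    then show False using n by simp
  qed
  moreover have "0 \<le> a2"
  proof (rule ccontr)
    assume n: "\<not> 0 \<le> a2"
    have "b \<le> a1 * 1 + a2 * ((\<bar>a1\<bar> + \<bar>b\<bar> + 1) / - a2)"
      using n by (intro b divide_pos_pos) auto
    then show False using n by simp
  qed
  ultimately have pos: "0 < a1 + a2" using ab(1) by (auto simp: a zero_prod_def)
  have "a1 / (a1 + a2) * fst x + a2 / (a1 + a2) * snd x \<le> 0" if "x \<in> S" for x
  proof -
    have "a1 * fst x + a2 * snd x \<le> 0"
      using ab(2)[OF that] \<open>b \<le> 0\<close> by (simp add: a inner_prod_def)
    then have "(a1 * fst x + a2 * snd x) / (a1 + a2) \<le> 0"
      using pos by (simp add: divide_nonpos_pos)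
    then show ?thesis by (simp add: add_divide_distrib)
  qed
  then show ?thesis
    using \<open>0 \<le> a1\<close> \<open>0 \<le> a2\<close> pos
    by (intro exI[of _ "a1 / (a1 + a2)"] exI[of _ "a2 / (a1 + a2)"])
       (simp add: add_divide_distrib[symmetric])
qed

text \<open>
  Convexity is stated pointwise because \<open>'b \<Rightarrow> real\<close> is not an instance of a vector space class.
  The induction replaces all previous coordinates by one nonnegative combination of them, which
  leaves a separation problem in the plane.
\<close>

lemma convex_alternative:
  fixes S :: "('b \<Rightarrow> real) set"
  assumes "finite B" "B \<noteq> {}"
    and "\<And>u v t. u \<in> S \<Longrightarrow> v \<in> S \<Longrightarrow> 0 \<le> t \<Longrightarrow> t \<le> 1 \<Longrightarrow> (\<lambda>b. (1 - t) * u b + t * v b) \<in> S"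
  shows "(\<exists>u\<in>S. \<forall>b\<in>B. 0 < u b) \<or>
    (\<exists>r. (\<forall>b\<in>B. 0 \<le> r b) \<and> sum r B = 1 \<and> (\<forall>u\<in>S. (\<Sum>b\<in>B. r b * u b) \<le> 0))"
  using assms
proof (induction B arbitrary: S rule: finite_ne_induct)
  case (singleton c)
  then show ?case by (auto intro!: exI[of _ "\<lambda>_. 1"] simp: not_less)
next
  case (insert c F)
  \<comment> \<open>Restricting to points already positive at \<open>c\<close> makes the first
    alternative for \<open>F\<close> settle the goal at once.\<close>
  define S' where "S' = {u \<in> S. 0 < u c}"
  have "(\<lambda>b. (1 - t) * u b + t * v b) \<in> S'" if "u \<in> S'" "v \<in> S'" "0 \<le> t" "t \<le> 1" for u v t
  proof -
    \<comment> \<open>For \<open>t = 0\<close> only \<open>u\<close> counts, and for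
      \<open>t > 0\<close> the term of \<open>v\<close> is strictly positive.\<close>
    have "0 < (1 - t) * u c + t * v c"
      using that by (cases "t = 0") (auto simp: S'_def intro!: add_nonneg_pos)
    then show ?thesis using that insert.prems by (auto simp: S'_def)
  qed
  from insert.IH[OF this] show ?case
  proof
    assume "\<exists>u\<in>S'. \<forall>b\<in>F. 0 < u b"
    then show ?thesis by (auto simp: S'_def)
  next
    assume "\<exists>r. (\<forall>b\<in>F. 0 \<le> r b) \<and> sum r F = 1 \<and> (\<forall>u\<in>S'. (\<Sum>b\<in>F. r b * u b) \<le> 0)"
    then obtain r where r: "\<And>b. b \<in> F \<Longrightarrow> 0 \<le> r b" "sum r F = 1" "\<And>u. u \<in> S' \<Longrightarrow> (\<Sum>b\<in>F. r b * u b) \<le> 0"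
      by blast
    \<comment> \<open>The planar image misses the open quadrant: a positive second coordinate puts
      \<open>u\<close> into \<open>S'\<close>, where the first coordinate is at most 0.\<close>
    let ?g = "\<lambda>u. (\<Sum>b\<in>F. r b * u b, u c)"
    have "convex (?g ` S)"
    proof (rule convexI, clarify)
      fix u v x y and s t :: real
      assume uv: "u \<in> S" "v \<in> S" and st: "0 \<le> s" "0 \<le> t" "s + t = 1"
      let ?w = "\<lambda>b. (1 - t) * u b + t * v b"
      have "s = 1 - t" using st by simp
      have "?w \<in> S" using uv st insert.prems by auto
      moreover have "s *\<^sub>R ?g u + t *\<^sub>R ?g v = ?g ?w"
        unfolding \<open>s = 1 - t\<close>
        by (simp add: distrib_left sum.distrib sum_distrib_left mult.left_commute)
      ultimately show "s *\<^sub>R ?g u + t *\<^sub>R ?g v \<in> ?g ` S" by (intro image_eqI)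
    qed
    moreover have False if "x \<in> ?g ` S" "0 < fst x" "0 < snd x" for x
      using that r(3) by (fastforce simp: S'_def)
    ultimately obtain s t where st: "0 \<le> s" "0 \<le> t" "s + t = 1"
      "\<And>x. x \<in> ?g ` S \<Longrightarrow> s * fst x + t * snd x \<le> 0"
      using convex_avoids_positive_quadrant[of "?g ` S"] by blast
    \<comment> \<open>The planar weight \<open>s\<close> is spread over \<open>F\<close> in
      proportion to \<open>r\<close>, and \<open>t\<close> goes to the new coordinate
      \<open>c\<close>.\<close>
    define r' where "r' b = (if b = c then t else s * r b)" for b
    have r': "sum (\<lambda>b. r' b * u b) (insert c F) = t * u c + s * (\<Sum>b\<in>F. r b * u b)" for u
    proof -
      have "(\<Sum>b\<in>F. r' b * u b) = s * (\<Sum>b\<in>F. r b * u b)"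
        unfolding sum_distrib_left using insert.hyps by (intro sum.cong) (auto simp: r'_def)
      then show ?thesis using insert.hyps by (simp add: r'_def)
    qed
    have "\<forall>b\<in>insert c F. 0 \<le> r' b" using st r by (simp add: r'_def)
    moreover have "sum r' (insert c F) = 1" using r'[of "\<lambda>_. 1"] r(2) st(3) by simp
    moreover have "\<forall>u\<in>S. (\<Sum>b\<in>insert c F. r' b * u b) \<le> 0"
      using st(4) unfolding r' by (fastforce simp: add.commute)
    ultimately show ?thesis by blast
  qed
qed

section \<open>Mixed actions and the minimax theorem\<close>

lemma mixed_of_weights:
  assumes "finite A" "\<And>a. a \<in> A \<Longrightarrow> 0 \<le> r a" "sum r A = 1"
  obtains p where "p \<in> mixed A" "\<And>a. a \<in> A \<Longrightarrow> pmf p a = r a"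
proof -
  define g where "g a = (if a \<in> A then r a else 0)" for a
  have nn: "0 \<le> g a" for a using assms by (simp add: g_def)
  have "(\<integral>\<^sup>+a. ennreal (g a) \<partial>count_space UNIV) = (\<Sum>a\<in>A. ennreal (g a))"
    using assms(1) by (intro nn_integral_count_space'[where A=A, simplified]) (auto simp: g_def)
  also have "\<dots> = ennreal (\<Sum>a\<in>A. g a)" using nn by simp
  also have "(\<Sum>a\<in>A. g a) = 1" using assms(3) by (simp add: g_def)
  finally have 1: "(\<integral>\<^sup>+a. ennreal (g a) \<partial>count_space UNIV) = 1" by simp
  show ?thesis
  proof (rule that[of "embed_pmf g"])
    show "embed_pmf g \<in> mixed A"
      using nn 1 by (auto simp: mixed_def set_embed_pmf g_def[abs_def])
    show "pmf (embed_pmf g) a = r a" if "a \<in> A" for a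
      using nn 1 that by (simp add: pmf_embed_pmf) (simp add: g_def)
  qed
qed

lemma sum_pmf_mixed: "finite A \<Longrightarrow> p \<in> mixed A \<Longrightarrow> (\<Sum>a\<in>A. pmf p a) = 1"
  by (simp add: mixed_def sum_pmf_eq_1)

lemma mixed_average_le:
  assumes "finite A" "p \<in> mixed A" "\<And>a. a \<in> A \<Longrightarrow> g a \<le> c"
  shows "(\<Sum>a\<in>A. pmf p a * g a) \<le> c"
proof -
  have "(\<Sum>a\<in>A. pmf p a * g a) \<le> (\<Sum>a\<in>A. pmf p a * c)"
    using assms(3) by (intro sum_mono mult_left_mono) auto
  then show ?thesis
    using sum_pmf_mixed[OF assms(1,2)] by (simp add: sum_distrib_right[symmetric])
qed

lemma mixed_average_ge:
  assumes "finite A" "p \<in> mixed A" "\<And>a. a \<in> A \<Longrightarrow> c \<le> g a"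
  shows "c \<le> (\<Sum>a\<in>A. pmf p a * g a)"
  using mixed_average_le[OF assms(1,2), of "\<lambda>a. - g a" "- c"] assms(3) by (simp add: sum_negf)

text \<open>Averaging each guarantee over the opponent's mixed action gives the same double sum in
  both cases.\<close>

lemma weak_duality:
  fixes f :: "'a \<Rightarrow> 'b \<Rightarrow> real"
  assumes "finite A" "finite B" "p \<in> mixed A" "r \<in> mixed B"
    and "\<And>b. b \<in> B \<Longrightarrow> c \<le> (\<Sum>a\<in>A. pmf p a * f a b)"
    and "\<And>a. a \<in> A \<Longrightarrow> (\<Sum>b\<in>B. pmf r b * f a b) \<le> d"
  shows "c \<le> d"
proof -
  have "c \<le> (\<Sum>b\<in>B. pmf r b * (\<Sum>a\<in>A. pmf p a * f a b))"
    using assms(2,4,5) by (rule mixed_average_ge)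
  also have "\<dots> = (\<Sum>a\<in>A. pmf p a * (\<Sum>b\<in>B. pmf r b * f a b))"
    unfolding sum_distrib_left by (subst sum.swap) (simp add: mult.left_commute)
  also have "\<dots> \<le> d"
    using assms(1,3,6) by (rule mixed_average_le)
  finally show ?thesis .
qed

text \<open>Take \<open>w\<close> as the supremum of the levels that rows can guarantee, and apply
  the alternative to the payoff vectors shifted down by \<open>w\<close>. None of them is positive
  in every column, so some column weights hold every row to at most \<open>w\<close>. Only the
  column optimum is attained here; rows reach every level below \<open>w\<close>.\<close>

lemma minimax_half:
  fixes f :: "'a \<Rightarrow> 'b \<Rightarrow> real"
  assumes A: "finite A" "A \<noteq> {}" and B: "finite B" "B \<noteq> {}"
  obtains r w where "r \<in> mixed B" "\<forall>a\<in>A. (\<Sum>b\<in>B. pmf r b * f a b) \<le> w"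
    "\<forall>c<w. \<exists>p\<in>mixed A. \<forall>b\<in>B. c \<le> (\<Sum>a\<in>A. pmf p a * f a b)"
proof -
  define K where "K = {c. \<exists>p\<in>mixed A. \<forall>b\<in>B. c \<le> (\<Sum>a\<in>A. pmf p a * f a b)}"
  define w where "w = Sup K"
  obtain a0 where a0: "a0 \<in> A" using A by blast
  obtain b0 where b0: "b0 \<in> B" using B by blast
  have sum_return: "(\<Sum>a\<in>A. pmf (return_pmf a0) a * g a) = g a0" if "a0 \<in> A" for a0 and g :: "'a \<Rightarrow> real"
    using A(1) that by (simp add: indicator_def sum.remove[of A a0])
  \<comment> \<open>A pure row guarantees its smallest entry, so \<open>K\<close> is
    nonempty.\<close>
  have "Min (f a0 ` B) \<in> K"
    unfolding K_def mem_Collect_eq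
    using a0 B by (intro bexI[of _ "return_pmf a0"]) (auto simp only: sum_return, auto simp: mixed_def)
  \<comment> \<open>Against the single column \<open>b0\<close> no level above its largest entry can
    be guaranteed.\<close>
  moreover have bdd: "bdd_above K"
  proof (rule bdd_aboveI)
    fix c assume "c \<in> K"
    then obtain p where p: "p \<in> mixed A" "c \<le> (\<Sum>a\<in>A. pmf p a * f a b0)" using b0 by (auto simp: K_def)
    note p(2)
    also have "\<dots> \<le> Max ((\<lambda>a. f a b0) ` A)"
      using A p by (intro mixed_average_le) auto
    finally show "c \<le> Max ((\<lambda>a. f a b0) ` A)" .
  qed
  ultimately have K: "K \<noteq> {}" by blast
  define S where "S = {\<lambda>b. (\<Sum>a\<in>A. pmf p a * f a b) - w | p. p \<in> mixed A}"
  have conv: "(\<lambda>b. (1 - t) * u b + t * v b) \<in> S" if uv: "u \<in> S" "v \<in> S" and t: "0 \<le> t" "t \<le> 1" for u v t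
  proof -
    obtain p q where p: "p \<in> mixed A" "u = (\<lambda>b. (\<Sum>a\<in>A. pmf p a * f a b) - w)"
      and q: "q \<in> mixed A" "v = (\<lambda>b. (\<Sum>a\<in>A. pmf q a * f a b) - w)"
      using uv unfolding S_def by blast
    have "(\<Sum>a\<in>A. (1 - t) * pmf p a + t * pmf q a) = 1"
      using sum_pmf_mixed[OF A(1)] p(1) q(1) by (simp add: sum.distrib sum_distrib_left[symmetric])
    then obtain m where m: "m \<in> mixed A" "\<And>a. a \<in> A \<Longrightarrow> pmf m a = (1 - t) * pmf p a + t * pmf q a"
      using mixed_of_weights[of A "\<lambda>a. (1 - t) * pmf p a + t * pmf q a"] A(1) t by auto
    have "(\<lambda>b. (1 - t) * u b + t * v b) = (\<lambda>b. (\<Sum>a\<in>A. pmf m a * f a b) - w)"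
      by (simp add: m(2) p(2) q(2) algebra_simps sum.distrib sum_distrib_left sum_subtractf)
    then show ?thesis using m(1) by (auto simp: S_def)
  qed
  have "\<not> (\<exists>u\<in>S. \<forall>b\<in>B. 0 < u b)"
  proof
    assume "\<exists>u\<in>S. \<forall>b\<in>B. 0 < u b"
    then obtain p where p: "p \<in> mixed A" "\<And>b. b \<in> B \<Longrightarrow> w < (\<Sum>a\<in>A. pmf p a * f a b)"
      by (auto simp: S_def)
    \<comment> \<open>As \<open>B\<close> is finite, the smallest coordinate is itself a guaranteed
      level, yet it would exceed the supremum.\<close>
    let ?m = "Min ((\<lambda>b. \<Sum>a\<in>A. pmf p a * f a b) ` B)"
    have "?m \<in> K" unfolding K_def mem_Collect_eq using p(1) B by (intro bexI[of _ p]) auto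
    then have "?m \<le> w" unfolding w_def using bdd by (rule cSup_upper)
    moreover have "w < ?m" using p B by simp
    ultimately show False by simp
  qed
  then obtain g where g: "\<And>b. b \<in> B \<Longrightarrow> 0 \<le> g b" "sum g B = 1" "\<And>u. u \<in> S \<Longrightarrow> (\<Sum>b\<in>B. g b * u b) \<le> 0"
    using convex_alternative[OF B conv] by blast
  obtain r where r: "r \<in> mixed B" "\<And>b. b \<in> B \<Longrightarrow> pmf r b = g b"
    using mixed_of_weights[OF B(1) g(1,2)] by blast
  have "(\<Sum>b\<in>B. pmf r b * f a b) \<le> w" if "a \<in> A" for a
  proof -
    \<comment> \<open>The pure action \<open>a\<close> realises this vector; since the weights
      \<open>g\<close> have sum 1, the shift by \<open>w\<close> can then be undone.\<close>
    have "(\<lambda>b. f a b - w) \<in> S"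
      unfolding S_def mem_Collect_eq
      by (intro exI[of _ "return_pmf a"]) (simp only: sum_return[OF that], simp add: mixed_def that)
    from g(3)[OF this] show ?thesis
      using g(2) by (simp add: r(2) algebra_simps sum_subtractf sum_distrib_left[symmetric])
  qed
  moreover have "\<exists>p\<in>mixed A. \<forall>b\<in>B. c \<le> (\<Sum>a\<in>A. pmf p a * f a b)" if c: "c < w" for c
  proof -
    obtain k where "k \<in> K" "c < k" using c K bdd by (auto simp: w_def less_cSup_iff)
    then obtain p where "p \<in> mixed A" "\<forall>b\<in>B. k \<le> (\<Sum>a\<in>A. pmf p a * f a b)" by (auto simp: K_def)
    with \<open>c < k\<close> have "\<forall>b\<in>B. c \<le> (\<Sum>a\<in>A. pmf p a * f a b)" by auto
    then show ?thesis using \<open>p \<in> mixed A\<close> by blast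
  qed
  ultimately show ?thesis using that r(1) by blast
qed

text \<open>One half is applied to \<open>f\<close>, the other to the negated game with the players
  exchanged, so that each side gets an attained optimum. A gap between the two levels would
  contradict weak duality.\<close>

lemma minimax:
  fixes f :: "'a \<Rightarrow> 'b \<Rightarrow> real"
  assumes A: "finite A" "A \<noteq> {}" and B: "finite B" "B \<noteq> {}"
  obtains p r w where "p \<in> mixed A" "r \<in> mixed B"
    "\<forall>b\<in>B. w \<le> (\<Sum>a\<in>A. pmf p a * f a b)"
    "\<forall>a\<in>A. (\<Sum>b\<in>B. pmf r b * f a b) \<le> w"
proof -
  obtain r w where r: "r \<in> mixed B" "\<forall>a\<in>A. (\<Sum>b\<in>B. pmf r b * f a b) \<le> w"
    "\<forall>c<w. \<exists>p\<in>mixed A. \<forall>b\<in>B. c \<le> (\<Sum>a\<in>A. pmf p a * f a b)"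
    using minimax_half[OF A B] .
  obtain p w' where "p \<in> mixed A" "\<forall>b\<in>B. (\<Sum>a\<in>A. pmf p a * - f a b) \<le> w'"
    "\<forall>c<w'. \<exists>r\<in>mixed B. \<forall>a\<in>A. c \<le> (\<Sum>b\<in>B. pmf r b * - f a b)"
    using minimax_half[OF B A] .
  then have p: "p \<in> mixed A" "\<forall>b\<in>B. - w' \<le> (\<Sum>a\<in>A. pmf p a * f a b)"
    "\<forall>c<w'. \<exists>r\<in>mixed B. \<forall>a\<in>A. (\<Sum>b\<in>B. pmf r b * f a b) \<le> - c"
    by (auto simp: sum_negf minus_le_iff le_minus_iff)
  have "w \<le> - w'"
  proof (rule ccontr)
    assume "\<not> w \<le> - w'"
    \<comment> \<open>Near-optimal actions reach only levels strictly short of \<open>w\<close> and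
      \<open>w'\<close>, so two distinct levels are placed in the gap: rows secure \<open>c\<close>
      while columns concede at most \<open>d < c\<close>.\<close>
    then obtain c d where cd: "- w' < d" "d < c" "c < w" by (meson dense not_le)
    obtain p' where p': "p' \<in> mixed A" "\<And>b. b \<in> B \<Longrightarrow> c \<le> (\<Sum>a\<in>A. pmf p' a * f a b)"
      using r(3) cd(3) by blast
    obtain r' where r': "r' \<in> mixed B" "\<And>a. a \<in> A \<Longrightarrow> (\<Sum>b\<in>B. pmf r' b * f a b) \<le> d"
      using p(3)[rule_format, of "- d"] cd(1) by auto
    have "c \<le> d" by (rule weak_duality[OF A(1) B(1) p'(1) r'(1) p'(2) r'(2)])
    then show False using cd(2) by simp
  qed
  then have "\<forall>b\<in>B. w \<le> (\<Sum>a\<in>A. pmf p a * f a b)" using p(2) by auto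
  then show ?thesis by (rule that[OF p(1) r(1) _ r(2)])
qed

lemma has_value_matrix_game:
  fixes f :: "'a \<Rightarrow> 'b \<Rightarrow> real"
  assumes A: "finite A" and B: "finite B" and p: "p \<in> mixed A" and r: "r \<in> mixed B"
    and pw: "\<And>b. b \<in> B \<Longrightarrow> w \<le> (\<Sum>a\<in>A. pmf p a * f a b)"
    and rw: "\<And>a. a \<in> A \<Longrightarrow> (\<Sum>b\<in>B. pmf r b * f a b) \<le> w"
  shows "has_value (mixed A) (mixed B) (\<lambda>p r. \<Sum>a\<in>A. \<Sum>b\<in>B. pmf p a * pmf r b * f a b) w"
proof (rule has_valueI)
  have "w \<le> (\<Sum>a\<in>A. \<Sum>b\<in>B. pmf p a * pmf q b * f a b)" if "q \<in> mixed B" for q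
  proof -
    have "w \<le> (\<Sum>b\<in>B. pmf q b * (\<Sum>a\<in>A. pmf p a * f a b))"
      using B that pw by (rule mixed_average_ge)
    also have "\<dots> = (\<Sum>a\<in>A. \<Sum>b\<in>B. pmf p a * pmf q b * f a b)"
      unfolding sum_distrib_left by (subst sum.swap) (simp add: ac_simps)
    finally show ?thesis .
  qed
  then show "\<exists>p\<in>mixed A. \<forall>q\<in>mixed B. c \<le> (\<Sum>a\<in>A. \<Sum>b\<in>B. pmf p a * pmf q b * f a b)" if "c < w" for c
    using p that by (meson less_imp_le order_trans)
  show "(\<Sum>a\<in>A. \<Sum>b\<in>B. pmf q a * pmf r b * f a b) \<le> w" if "q \<in> mixed A" for q
    using mixed_average_le[OF A that rw] by (simp add: sum_distrib_left ac_simps)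
qed (rule r)

text \<open>Uniqueness of the value resolves the definite description here; the later facts about
  \<open>matrix_Val\<close> use only these saddle inequalities.\<close>

lemma matrix_Val_saddle:
  fixes f :: "'a \<Rightarrow> 'b \<Rightarrow> real"
  assumes A: "finite A" "A \<noteq> {}" and B: "finite B" "B \<noteq> {}"
  obtains p r where "p \<in> mixed A" "r \<in> mixed B"
    "\<And>b. b \<in> B \<Longrightarrow> matrix_Val A B f \<le> (\<Sum>a\<in>A. pmf p a * f a b)"
    "\<And>a. a \<in> A \<Longrightarrow> (\<Sum>b\<in>B. pmf r b * f a b) \<le> matrix_Val A B f"
proof -
  obtain p r w where *: "p \<in> mixed A" "r \<in> mixed B"
    "\<forall>b\<in>B. w \<le> (\<Sum>a\<in>A. pmf p a * f a b)"
    "\<forall>a\<in>A. (\<Sum>b\<in>B. pmf r b * f a b) \<le> w"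
    using minimax[OF A B] .
  have "matrix_Val A B f = w"
    unfolding matrix_Val_def
    using has_value_matrix_game[OF A(1) B(1) *(1,2), of w f] *(3,4) has_value_unique by (intro the_equality) blast+
  with * show ?thesis by (intro that[of p r]) auto
qed

text \<open>An optimal row for \<open>f\<close> meets an optimal column for \<open>g\<close>. The
  case \<open>e = 0\<close> is monotonicity, and a uniform bound \<open>e\<close> gives
  nonexpansiveness.\<close>

lemma matrix_Val_le_add:
  fixes f g :: "'a \<Rightarrow> 'b \<Rightarrow> real"
  assumes A: "finite A" "A \<noteq> {}" and B: "finite B" "B \<noteq> {}"
    and le: "\<And>a b. a \<in> A \<Longrightarrow> b \<in> B \<Longrightarrow> f a b \<le> g a b + e"
  shows "matrix_Val A B f \<le> matrix_Val A B g + e"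
proof -
  obtain p where p: "p \<in> mixed A" "\<And>b. b \<in> B \<Longrightarrow> matrix_Val A B f \<le> (\<Sum>a\<in>A. pmf p a * f a b)"
    using matrix_Val_saddle[OF A B] by metis
  obtain r where r: "r \<in> mixed B" "\<And>a. a \<in> A \<Longrightarrow> (\<Sum>b\<in>B. pmf r b * g a b) \<le> matrix_Val A B g"
    using matrix_Val_saddle[OF A B] by metis
  show ?thesis
  proof (rule weak_duality[OF A(1) B(1) p(1) r(1) p(2)])
    fix a assume a: "a \<in> A"
    have "(\<Sum>b\<in>B. pmf r b * f a b) \<le> (\<Sum>b\<in>B. pmf r b * (g a b + e))"
      using le a by (intro sum_mono mult_left_mono) auto
    also have "\<dots> = (\<Sum>b\<in>B. pmf r b * g a b) + e"
      using sum_pmf_mixed[OF B(1) r(1)]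
      by (simp add: algebra_simps sum.distrib sum_distrib_left[symmetric])
    finally show "(\<Sum>b\<in>B. pmf r b * f a b) \<le> matrix_Val A B g + e"
      using r(2)[OF a] by simp
  qed
qed

lemma matrix_Val_optimal_row:
  fixes f :: "'a \<Rightarrow> 'b \<Rightarrow> real"
  assumes "finite A" "A \<noteq> {}" "finite B" "B \<noteq> {}"
  shows "\<exists>p\<in>mixed A. \<forall>b\<in>B. matrix_Val A B f \<le> (\<Sum>a\<in>A. pmf p a * f a b)"
proof -
  obtain p where "p \<in> mixed A" "\<And>b. b \<in> B \<Longrightarrow> matrix_Val A B f \<le> (\<Sum>a\<in>A. pmf p a * f a b)"
    using matrix_Val_saddle[OF assms] by metis
  then show ?thesis by blast
qed

lemma matrix_Val_optimal_column:
  fixes f :: "'a \<Rightarrow> 'b \<Rightarrow> real"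
  assumes "finite A" "A \<noteq> {}" "finite B" "B \<noteq> {}"
  shows "\<exists>r\<in>mixed B. \<forall>a\<in>A. (\<Sum>b\<in>B. pmf r b * f a b) \<le> matrix_Val A B f"
proof -
  obtain r where "r \<in> mixed B" "\<And>a. a \<in> A \<Longrightarrow> (\<Sum>b\<in>B. pmf r b * f a b) \<le> matrix_Val A B f"
    using matrix_Val_saddle[OF assms] by metis
  then show ?thesis by blast
qed

lemma matrix_Val_ge:
  fixes f :: "'a \<Rightarrow> 'b \<Rightarrow> real"
  assumes A: "finite A" "A \<noteq> {}" and B: "finite B" "B \<noteq> {}"
    and ge: "\<And>a b. a \<in> A \<Longrightarrow> b \<in> B \<Longrightarrow> c \<le> f a b"
  shows "c \<le> matrix_Val A B f"
proof -
  obtain a where a: "a \<in> A" using A by blast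
  obtain r where r: "r \<in> mixed B" "\<And>a. a \<in> A \<Longrightarrow> (\<Sum>b\<in>B. pmf r b * f a b) \<le> matrix_Val A B f"
    using matrix_Val_saddle[OF A B] by metis
  show ?thesis
    using mixed_average_ge[OF B(1) r(1), of c "f a"] ge[OF a] r(2)[OF a] by fastforce
qed

lemma matrix_Val_le:
  fixes f :: "'a \<Rightarrow> 'b \<Rightarrow> real"
  assumes A: "finite A" "A \<noteq> {}" and B: "finite B" "B \<noteq> {}"
    and le: "\<And>a b. a \<in> A \<Longrightarrow> b \<in> B \<Longrightarrow> f a b \<le> c"
  shows "matrix_Val A B f \<le> c"
proof -
  obtain b where b: "b \<in> B" using B by blast
  obtain p where p: "p \<in> mixed A" "\<And>b. b \<in> B \<Longrightarrow> matrix_Val A B f \<le> (\<Sum>a\<in>A. pmf p a * f a b)"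
    using matrix_Val_saddle[OF A B] by metis
  show ?thesis
    using mixed_average_le[OF A(1) p(1), of "\<lambda>a. f a b" c] le[OF _ b] p(2)[OF b] by fastforce
qed

lemma mixed_expectation:
  "finite A \<Longrightarrow> p \<in> mixed A \<Longrightarrow> measure_pmf.expectation p g = (\<Sum>a\<in>A. pmf p a * (g a :: real))"
  by (subst integral_measure_pmf_real[where A=A]) (auto simp: mixed_def mult.commute)

section \<open>The Shapley operator\<close>

lemma payoff_nonneg [simp]: "0 \<le> payoff s"
  by (simp add: payoff_def)

lemma payoff_Terminal [simp]: "payoff Terminal = 0"
  by (simp add: payoff_def)

lemma Terminal_in_states [simp]: "Terminal \<in> states G"
  by (simp add: states_def)

lemma transition_after_capture: "C1_capture s \<Longrightarrow> transition \<sigma>3 s a b = return_pmf Terminal"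
  by (cases s) auto

locale scpr =
  fixes G :: "('a, 'b) pre_digraph" and \<sigma>3 :: "'a state \<Rightarrow> 'a pmf"
  assumes wf: "wf_digraph G" and finite_verts: "finite (verts G)"
    and robber: "robber_strategy G \<sigma>3"
begin

lemmas finite_states' [simp] = finite_states[OF finite_verts]

definition stage_game :: "('a state \<Rightarrow> real) \<Rightarrow> 'a state \<Rightarrow> 'a \<Rightarrow> 'a \<Rightarrow> real" where
  "stage_game u s a1 a2 = payoff s + (\<Sum>s'\<in>states G. pmf (transition \<sigma>3 s a1 a2) s' * u s')"

definition shapley :: "('a state \<Rightarrow> real) \<Rightarrow> 'a state \<Rightarrow> real" where
  "shapley u s = (case s of Terminal \<Rightarrow> 0
     | Tokens x1 x2 x3 \<Rightarrow> matrix_Val (closed_nbhd G x1) (closed_nbhd G x2) (stage_game u s))"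

lemma value_iter_Suc: "value_iter G \<sigma>3 (Suc i) = shapley (value_iter G \<sigma>3 i)"
proof
  show "value_iter G \<sigma>3 (Suc i) s = shapley (value_iter G \<sigma>3 i) s" for s
    by (cases s) (simp_all add: shapley_def stage_game_def[abs_def])
qed

lemma value_iter_0: "value_iter G \<sigma>3 0 = payoff"
  by (rule ext) (simp split: state.split)

lemma value_iter_Terminal [simp]: "value_iter G \<sigma>3 i Terminal = 0"
  by (cases i) simp_all

lemma closed_nbhd_finite_nonempty:
  assumes "x \<in> verts G"
  shows "finite (closed_nbhd G x)" "closed_nbhd G x \<noteq> {}"
  using closed_nbhd_subset[OF wf assms] finite_verts finite_subset by (auto simp: closed_nbhd_def)

lemma states_Tokens_iff [simp]:
  "Tokens x1 x2 x3 \<in> states G \<longleftrightarrow> x1 \<in> verts G \<and> x2 \<in> verts G \<and> x3 \<in> verts G"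
  by (auto simp: states_def active_states_def)

text \<open>An inequality suffices, and it holds for arbitrary distributions, so legality of the
  actions need not be tracked when stage games are estimated.\<close>

lemma sum_pmf_states_le_1: "(\<Sum>s\<in>states G. pmf p s) \<le> 1"
  by (simp add: measure_measure_pmf_finite[symmetric])

text \<open>Transition probabilities on \<open>states G\<close> have total mass at most one, so a
  uniform error \<open>e\<close> in the continuation costs at most \<open>e\<close>; the matrix
  value then passes it on. With \<open>e = 0\<close> this is monotonicity of the operator.\<close>

lemma shapley_le_add:
  assumes s: "s \<in> states G" and e: "0 \<le> e"
    and le: "\<And>s'. s' \<in> states G \<Longrightarrow> u s' \<le> v s' + e"
  shows "shapley u s \<le> shapley v s + e"
proof (cases s)
  case (Tokens x1 x2 x3)
  have "stage_game u s a b \<le> stage_game v s a b + e" for a b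
  proof -
    let ?p = "pmf (transition \<sigma>3 s a b)"
    have "(\<Sum>s'\<in>states G. ?p s' * u s') \<le> (\<Sum>s'\<in>states G. ?p s' * (v s' + e))"
      using le by (intro sum_mono mult_left_mono) auto
    also have "\<dots> = (\<Sum>s'\<in>states G. ?p s' * v s') + (\<Sum>s'\<in>states G. ?p s') * e"
      by (simp add: distrib_left sum.distrib sum_distrib_right)
    also have "\<dots> \<le> (\<Sum>s'\<in>states G. ?p s' * v s') + 1 * e"
      using e sum_pmf_states_le_1 by (intro add_mono mult_right_mono) auto
    finally show ?thesis by (simp add: stage_game_def)
  qed
  then show ?thesis
    using s matrix_Val_le_add[OF closed_nbhd_finite_nonempty closed_nbhd_finite_nonempty,
      of x1 x2 "stage_game u s" "stage_game v s" e]
    by (simp add: Tokens shapley_def)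
qed (simp add: shapley_def e)

lemma value_iter_nonneg: "s \<in> states G \<Longrightarrow> 0 \<le> value_iter G \<sigma>3 i s"
proof (induction i arbitrary: s)
  case (Suc i)
  show ?case
  proof (cases s)
    case (Tokens x1 x2 x3)
    have "0 \<le> stage_game (value_iter G \<sigma>3 i) s a b" for a b
      using Suc.IH by (auto simp: stage_game_def intro!: add_nonneg_nonneg sum_nonneg)
    then show ?thesis
      using Suc.prems matrix_Val_ge[OF closed_nbhd_finite_nonempty closed_nbhd_finite_nonempty,
        of x1 x2 0 "stage_game (value_iter G \<sigma>3 i) s"]
      unfolding value_iter_Suc by (simp add: Tokens shapley_def)
  qed simp
qed (simp add: value_iter_0 del: value_iter.simps)

text \<open>Payoff and continuation never add up: a payoff of 1 occurs only at a C1-capture state,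
  whose successor is \<open>Terminal\<close> with value 0.\<close>

lemma value_iter_le_1: "s \<in> states G \<Longrightarrow> value_iter G \<sigma>3 i s \<le> 1"
proof (induction i arbitrary: s)
  case 0
  show ?case by (simp add: value_iter_0 payoff_def del: value_iter.simps)
next
  case (Suc i)
  let ?u = "value_iter G \<sigma>3 i"
  show ?case
  proof (cases s)
    case (Tokens x1 x2 x3)
    have "stage_game ?u s a b \<le> 1" for a b
    proof (cases "C1_capture s")
      case True
      have "(\<Sum>s'\<in>states G. pmf (return_pmf Terminal) s' * ?u s') = 0"
        by (intro sum.neutral) (auto simp: indicator_def)
      with True show ?thesis
        by (simp add: stage_game_def transition_after_capture payoff_def del: pmf_return)
    next
      case False
      have "(\<Sum>s'\<in>states G. pmf (transition \<sigma>3 s a b) s' * ?u s') \<le>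
          (\<Sum>s'\<in>states G. pmf (transition \<sigma>3 s a b) s' * 1)"
        using Suc.IH by (intro sum_mono mult_left_mono) auto
      also have "\<dots> \<le> 1" using sum_pmf_states_le_1 by simp
      finally show ?thesis using False by (simp add: stage_game_def payoff_def)
    qed
    then show ?thesis
      using Suc.prems matrix_Val_le[OF closed_nbhd_finite_nonempty closed_nbhd_finite_nonempty,
        of x1 x2 "stage_game ?u s" 1]
      unfolding value_iter_Suc by (simp add: Tokens shapley_def)
  qed simp
qed

text \<open>The first iterate dominates \<open>payoff\<close> because the stage game adds a
  nonnegative continuation to it; monotonicity of the operator propagates this.\<close>

lemma value_iter_mono: "s \<in> states G \<Longrightarrow> value_iter G \<sigma>3 i s \<le> value_iter G \<sigma>3 (Suc i) s"
proof (induction i arbitrary: s)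
  case 0
  show ?case
  proof (cases s)
    case (Tokens x1 x2 x3)
    have "payoff s \<le> stage_game payoff s a b" for a b
      by (auto simp: stage_game_def intro!: sum_nonneg)
    then show ?thesis
      using 0 matrix_Val_ge[OF closed_nbhd_finite_nonempty closed_nbhd_finite_nonempty,
        of x1 x2 "payoff s" "stage_game payoff s"]
      unfolding value_iter_Suc value_iter_0 by (simp add: Tokens shapley_def)
  qed simp
next
  case (Suc i)
  then show ?case
    using shapley_le_add[OF Suc.prems, of 0 "value_iter G \<sigma>3 i" "value_iter G \<sigma>3 (Suc i)"]
    unfolding value_iter_Suc[symmetric] by simp
qed

definition limit_value :: "'a state \<Rightarrow> real" where
  "limit_value s = lim (\<lambda>i. value_iter G \<sigma>3 i s)"

lemma value_iter_tendsto:
  assumes "s \<in> states G"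
  shows "(\<lambda>i. value_iter G \<sigma>3 i s) \<longlonglongrightarrow> limit_value s"
    and value_iter_le_limit: "value_iter G \<sigma>3 i s \<le> limit_value s"
proof -
  have inc: "incseq (\<lambda>i. value_iter G \<sigma>3 i s)"
    by (rule incseq_SucI) (rule value_iter_mono[OF assms])
  obtain L where "(\<lambda>i. value_iter G \<sigma>3 i s) \<longlonglongrightarrow> L"
    using incseq_convergent[OF inc, of 1] value_iter_le_1[OF assms] by blast
  then show lim: "(\<lambda>i. value_iter G \<sigma>3 i s) \<longlonglongrightarrow> limit_value s"
    unfolding limit_value_def by (simp add: limI)
  show "value_iter G \<sigma>3 i s \<le> limit_value s"
    by (rule incseq_le[OF inc lim])
qed

lemma limit_value_nonneg: "s \<in> states G \<Longrightarrow> 0 \<le> limit_value s"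
  using value_iter_nonneg[of s 0] value_iter_le_limit[of s 0] by linarith

lemma limit_value_Terminal [simp]: "limit_value Terminal = 0"
  by (simp add: limit_value_def)

text \<open>Nonexpansiveness bounds the image of the limit from above by the next iterate plus a
  vanishing error; monotonicity bounds it from below by every iterate.\<close>

lemma shapley_limit_value:
  assumes s: "s \<in> states G"
  shows "shapley limit_value s = limit_value s"
proof -
  \<comment> \<open>The sum of the gaps over the finitely many states dominates each of them, so
    pointwise convergence yields a uniform error.\<close>
  define e where "e i = (\<Sum>s'\<in>states G. limit_value s' - value_iter G \<sigma>3 i s')" for i
  have "e \<longlonglongrightarrow> (\<Sum>s'\<in>states G. limit_value s' - limit_value s')"
    unfolding e_def by (intro tendsto_sum tendsto_diff tendsto_const value_iter_tendsto)
  then have e0: "e \<longlonglongrightarrow> 0" by simp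
  have e_nonneg: "0 \<le> e i" for i
    unfolding e_def using value_iter_le_limit by (intro sum_nonneg) simp
  have near: "limit_value s' \<le> value_iter G \<sigma>3 i s' + e i" if "s' \<in> states G" for s' i
    using member_le_sum[of s' "states G" "\<lambda>s'. limit_value s' - value_iter G \<sigma>3 i s'"] that value_iter_le_limit
    by (simp add: e_def)
  have lower: "shapley limit_value s \<le> value_iter G \<sigma>3 (Suc i) s + e i" for i
    unfolding value_iter_Suc by (rule shapley_le_add[OF s e_nonneg near])
  have "(\<lambda>i. value_iter G \<sigma>3 (Suc i) s + e i) \<longlonglongrightarrow> limit_value s + 0"
    by (intro tendsto_add e0 LIMSEQ_Suc value_iter_tendsto s)
  then have "shapley limit_value s \<le> limit_value s"
    using lower by (intro LIMSEQ_le_const) auto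
  moreover have "value_iter G \<sigma>3 (Suc i) s \<le> shapley limit_value s" for i
    using shapley_le_add[OF s, of 0 "value_iter G \<sigma>3 i" limit_value] value_iter_le_limit
    unfolding value_iter_Suc by simp
  then have "limit_value s \<le> shapley limit_value s"
    by (intro LIMSEQ_le_const2[OF LIMSEQ_Suc[OF value_iter_tendsto(1)[OF s]]]) auto
  ultimately show ?thesis by simp
qed

section \<open>Optimal strategies from optimal mixed actions\<close>

lemma strategy_support:
  assumes h: "h \<noteq> []" "set h \<subseteq> states G" "last h = Tokens x1 x2 x3"
  shows "\<sigma>1 \<in> C1_strategies G \<Longrightarrow> \<sigma>1 h \<in> mixed (closed_nbhd G x1)"
    and "\<sigma>2 \<in> C2_strategies G \<Longrightarrow> \<sigma>2 h \<in> mixed (closed_nbhd G x2)"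
proof -
  have "h = butlast h @ [Tokens x1 x2 x3]" using h by (metis append_butlast_last_id)
  then show "\<sigma>1 \<in> C1_strategies G \<Longrightarrow> \<sigma>1 h \<in> mixed (closed_nbhd G x1)"
    and "\<sigma>2 \<in> C2_strategies G \<Longrightarrow> \<sigma>2 h \<in> mixed (closed_nbhd G x2)"
    using h(2) unfolding C1_strategies_def C2_strategies_def mixed_def
    by (metis (mono_tags, lifting) mem_Collect_eq)+
qed

lemma last_in_states: "h \<noteq> [] \<Longrightarrow> set h \<subseteq> states G \<Longrightarrow> last h \<in> states G"
  using last_in_set by blast

text \<open>Given the history, the two actions are drawn independently, so one step of the play is
  the bilinear extension of the stage game. This links plays to matrix games.\<close>

lemma expectation_step:
  assumes 1: "\<sigma>1 \<in> C1_strategies G" and 2: "\<sigma>2 \<in> C2_strategies G"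
    and h: "h \<noteq> []" "set h \<subseteq> states G" "last h = Tokens x1 x2 x3"
  shows "payoff (last h) + measure_pmf.expectation (step \<sigma>3 \<sigma>1 \<sigma>2 h) u =
    (\<Sum>a\<in>closed_nbhd G x1. \<Sum>b\<in>closed_nbhd G x2.
      pmf (\<sigma>1 h) a * pmf (\<sigma>2 h) b * stage_game u (last h) a b)"
proof -
  let ?A = "closed_nbhd G x1" and ?B = "closed_nbhd G x2"
  let ?q = "\<lambda>a b. transition \<sigma>3 (last h) a b"
  have x: "x1 \<in> verts G" "x2 \<in> verts G" "x3 \<in> verts G" using last_in_states[OF h(1,2)] h(3) by auto
  have A: "finite ?A" and B: "finite ?B" using closed_nbhd_finite_nonempty x by auto
  have pA: "\<sigma>1 h \<in> mixed ?A" and pB: "\<sigma>2 h \<in> mixed ?B" using strategy_support[OF h] 1 2 by auto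
  have "(\<Sum>s\<in>states G. pmf (step \<sigma>3 \<sigma>1 \<sigma>2 h) s * u s) =
      (\<Sum>s\<in>states G. \<Sum>a\<in>?A. \<Sum>b\<in>?B. pmf (\<sigma>1 h) a * pmf (\<sigma>2 h) b * pmf (?q a b) s * u s)"
    unfolding step_def pmf_bind mixed_expectation[OF A pA] mixed_expectation[OF B pB]
    by (simp add: sum_distrib_left sum_distrib_right mult.assoc)
  also have "\<dots> = (\<Sum>a\<in>?A. \<Sum>b\<in>?B. pmf (\<sigma>1 h) a * pmf (\<sigma>2 h) b * (\<Sum>s\<in>states G. pmf (?q a b) s * u s))"
    by (subst sum.swap, rule sum.cong[OF refl], subst sum.swap) (simp add: sum_distrib_left ac_simps)
  finally have E: "(\<Sum>s\<in>states G. pmf (step \<sigma>3 \<sigma>1 \<sigma>2 h) s * u s) = \<dots>" .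
  have "measure_pmf.expectation (step \<sigma>3 \<sigma>1 \<sigma>2 h) u = (\<Sum>s\<in>states G. pmf (step \<sigma>3 \<sigma>1 \<sigma>2 h) s * u s)"
    using set_pmf_step_subset[OF wf robber 1 2 h(1,2)]
    by (intro mixed_expectation) (simp_all add: mixed_def)
  moreover have "payoff (last h) = (\<Sum>a\<in>?A. \<Sum>b\<in>?B. pmf (\<sigma>1 h) a * pmf (\<sigma>2 h) b * payoff (last h))"
    using sum_pmf_mixed[OF A pA] sum_pmf_mixed[OF B pB]
    by (simp add: sum_distrib_left[symmetric] sum_distrib_right[symmetric])
  ultimately show ?thesis
    unfolding E stage_game_def by (simp add: distrib_left sum.distrib)
qed

lemma step_Terminal: "last h = Terminal \<Longrightarrow> step \<sigma>3 \<sigma>1 \<sigma>2 h = return_pmf Terminal"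
  by (simp add: step_def)

text \<open>The continuation payoff may depend on the history because in the truncated game it
  depends on the remaining horizon, which is read off the history's length. An optimal row is good
  against every column, hence against whatever \<open>\<sigma>2\<close> mixes.\<close>

lemma optimal_C1_strategy:
  assumes U: "\<And>h. U h Terminal = 0"
  obtains \<sigma>1 where "\<sigma>1 \<in> C1_strategies G"
    "\<And>\<sigma>2 h. \<sigma>2 \<in> C2_strategies G \<Longrightarrow> h \<noteq> [] \<Longrightarrow> set h \<subseteq> states G \<Longrightarrow>
      shapley (U h) (last h) \<le> payoff (last h) + measure_pmf.expectation (step \<sigma>3 \<sigma>1 \<sigma>2 h) (U h)"
proof -
  \<comment> \<open>The strategy must be total: for histories ending in \<open>Terminal\<close> or
    outside \<open>states G\<close> the condition is vacuous.\<close>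
  have "\<exists>p. \<forall>x1 x2 x3. last h = Tokens x1 x2 x3 \<longrightarrow> last h \<in> states G \<longrightarrow>
      p \<in> mixed (closed_nbhd G x1) \<and> (\<forall>b\<in>closed_nbhd G x2.
        shapley (U h) (last h) \<le> (\<Sum>a\<in>closed_nbhd G x1. pmf p a * stage_game (U h) (last h) a b))" for h
  proof (cases "last h")
    case (Tokens x1 x2 x3)
    show ?thesis
    proof (cases "last h \<in> states G")
      case True
      then have "x1 \<in> verts G" "x2 \<in> verts G" using Tokens by auto
      then obtain p where "p \<in> mixed (closed_nbhd G x1)"
        "\<forall>b\<in>closed_nbhd G x2. matrix_Val (closed_nbhd G x1) (closed_nbhd G x2) (stage_game (U h) (last h)) \<le>
          (\<Sum>a\<in>closed_nbhd G x1. pmf p a * stage_game (U h) (last h) a b)"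
        using matrix_Val_optimal_row[OF closed_nbhd_finite_nonempty closed_nbhd_finite_nonempty,
          of x1 x2 "stage_game (U h) (last h)"] by blast
      then show ?thesis using Tokens by (intro exI[of _ p]) (simp add: shapley_def)
    qed auto
  qed auto
  then obtain \<sigma>1 where \<sigma>1: "\<And>h x1 x2 x3. last h = Tokens x1 x2 x3 \<Longrightarrow> last h \<in> states G \<Longrightarrow>
      \<sigma>1 h \<in> mixed (closed_nbhd G x1) \<and> (\<forall>b\<in>closed_nbhd G x2.
        shapley (U h) (last h) \<le> (\<Sum>a\<in>closed_nbhd G x1. pmf (\<sigma>1 h) a * stage_game (U h) (last h) a b))"
    by metis
  show ?thesis
  proof (rule that)
    show C1: "\<sigma>1 \<in> C1_strategies G"
      unfolding C1_strategies_def
    proof (clarsimp, goal_cases)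
      case (1 h x1 x2 x3 x)
      then show ?case using \<sigma>1[of "h @ [Tokens x1 x2 x3]"] by (auto simp: mixed_def)
    qed
    fix \<sigma>2 h assume 2: "\<sigma>2 \<in> C2_strategies G" and h: "h \<noteq> []" "set h \<subseteq> states G"
    show "shapley (U h) (last h) \<le> payoff (last h) + measure_pmf.expectation (step \<sigma>3 \<sigma>1 \<sigma>2 h) (U h)"
    proof (cases "last h")
      case Terminal
      then show ?thesis by (simp add: step_Terminal shapley_def U)
    next
      case (Tokens x1 x2 x3)
      have s: "last h \<in> states G" using last_in_states[OF h] .
      then have B: "finite (closed_nbhd G x2)" using Tokens closed_nbhd_finite_nonempty by auto
      have "shapley (U h) (last h) \<le> (\<Sum>b\<in>closed_nbhd G x2. pmf (\<sigma>2 h) b *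
          (\<Sum>a\<in>closed_nbhd G x1. pmf (\<sigma>1 h) a * stage_game (U h) (last h) a b))"
        using \<sigma>1[OF Tokens s] by (intro mixed_average_ge[OF B strategy_support(2)[OF h Tokens 2]]) auto
      also have "\<dots> = payoff (last h) + measure_pmf.expectation (step \<sigma>3 \<sigma>1 \<sigma>2 h) (U h)"
        unfolding expectation_step[OF C1 2 h Tokens] sum_distrib_left
        by (subst sum.swap) (simp add: ac_simps)
      finally show ?thesis .
    qed
  qed
qed

text \<open>With one fixed continuation payoff the choice depends on the current state alone, so the
  strategy is stationary.\<close>

lemma optimal_C2_strategy:
  assumes u: "u Terminal = 0"
  obtains \<sigma>2 where "\<sigma>2 \<in> C2_strategies G"
    "\<And>\<sigma>1 h. \<sigma>1 \<in> C1_strategies G \<Longrightarrow> h \<noteq> [] \<Longrightarrow> set h \<subseteq> states G \<Longrightarrow>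
      payoff (last h) + measure_pmf.expectation (step \<sigma>3 \<sigma>1 \<sigma>2 h) u \<le> shapley u (last h)"
proof -
  have "\<exists>r. \<forall>x1 x2 x3. s = Tokens x1 x2 x3 \<longrightarrow> s \<in> states G \<longrightarrow>
      r \<in> mixed (closed_nbhd G x2) \<and> (\<forall>a\<in>closed_nbhd G x1.
        (\<Sum>b\<in>closed_nbhd G x2. pmf r b * stage_game u s a b) \<le> shapley u s)" for s
  proof (cases s)
    case (Tokens x1 x2 x3)
    show ?thesis
    proof (cases "s \<in> states G")
      case True
      then have "x1 \<in> verts G" "x2 \<in> verts G" using Tokens by auto
      then obtain r where "r \<in> mixed (closed_nbhd G x2)"
        "\<forall>a\<in>closed_nbhd G x1. (\<Sum>b\<in>closed_nbhd G x2. pmf r b * stage_game u s a b) \<le>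
          matrix_Val (closed_nbhd G x1) (closed_nbhd G x2) (stage_game u s)"
        using matrix_Val_optimal_column[OF closed_nbhd_finite_nonempty closed_nbhd_finite_nonempty,
          of x1 x2 "stage_game u s"] by blast
      then show ?thesis using Tokens by (intro exI[of _ r]) (simp add: shapley_def)
    qed auto
  qed auto
  then obtain \<rho> where \<rho>: "\<And>s x1 x2 x3. s = Tokens x1 x2 x3 \<Longrightarrow> s \<in> states G \<Longrightarrow>
      \<rho> s \<in> mixed (closed_nbhd G x2) \<and> (\<forall>a\<in>closed_nbhd G x1.
        (\<Sum>b\<in>closed_nbhd G x2. pmf (\<rho> s) b * stage_game u s a b) \<le> shapley u s)"
    by metis
  let ?\<sigma>2 = "\<lambda>h. \<rho> (last h)"
  show ?thesis
  proof (rule that)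
    show C2: "?\<sigma>2 \<in> C2_strategies G"
      unfolding C2_strategies_def
    proof (clarsimp, goal_cases)
      case (1 h x1 x2 x3 x)
      then show ?case using \<rho>[of "Tokens x1 x2 x3"] by (auto simp: mixed_def)
    qed
    fix \<sigma>1 h assume 1: "\<sigma>1 \<in> C1_strategies G" and h: "h \<noteq> []" "set h \<subseteq> states G"
    show "payoff (last h) + measure_pmf.expectation (step \<sigma>3 \<sigma>1 ?\<sigma>2 h) u \<le> shapley u (last h)"
    proof (cases "last h")
      case Terminal
      then show ?thesis by (simp add: step_Terminal shapley_def u)
    next
      case (Tokens x1 x2 x3)
      have s: "last h \<in> states G" using last_in_states[OF h] .
      then have A: "finite (closed_nbhd G x1)" using Tokens closed_nbhd_finite_nonempty by auto
      have "payoff (last h) + measure_pmf.expectation (step \<sigma>3 \<sigma>1 ?\<sigma>2 h) u =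
          (\<Sum>a\<in>closed_nbhd G x1. pmf (\<sigma>1 h) a *
            (\<Sum>b\<in>closed_nbhd G x2. pmf (\<rho> (last h)) b * stage_game u (last h) a b))"
        unfolding expectation_step[OF 1 C2 h Tokens] sum_distrib_left by (simp add: ac_simps)
      also have "\<dots> \<le> shapley u (last h)"
        using \<rho>[OF Tokens s] by (intro mixed_average_le[OF A strategy_support(1)[OF h Tokens 1]]) auto
      finally show ?thesis .
    qed
  qed
qed

end

section \<open>The law of the play\<close>

text \<open>A play meets at most one C1-capture state, so at most one term of the series is
  nonzero.\<close>

lemma sum_payoff_absorbing:
  assumes capture: "\<And>n. C1_capture (\<omega> n) \<Longrightarrow> \<omega> (Suc n) = Terminal"
    and absorbing: "\<And>n. \<omega> n = Terminal \<Longrightarrow> \<omega> (Suc n) = Terminal"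
  shows "summable (\<lambda>t. payoff (\<omega> t))" and "(\<Sum>t. payoff (\<omega> t)) \<le> 1"
proof -
  have "\<exists>m. \<forall>t. t \<noteq> m \<longrightarrow> payoff (\<omega> t) = 0"
  proof (cases "\<exists>m. C1_capture (\<omega> m)")
    case True
    \<comment> \<open>Nothing is paid before the first capture, and right after it the play is in
      \<open>Terminal\<close> for good.\<close>
    then obtain m where m: "C1_capture (\<omega> m)" "\<And>t. t < m \<Longrightarrow> \<not> C1_capture (\<omega> t)"
      using exists_least_iff[of "\<lambda>m. C1_capture (\<omega> m)"] by blast
    have after: "\<omega> (Suc (m + k)) = Terminal" for k
      by (induction k) (simp_all add: capture[OF m(1)] absorbing)
    have "payoff (\<omega> t) = 0" if t: "t \<noteq> m" for t
    proof (cases "t < m")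
      case False
      then obtain k where "t = Suc (m + k)" using t less_imp_Suc_add[of m t] by auto
      then show ?thesis by (simp add: after)
    qed (use m in \<open>simp add: payoff_def\<close>)
    then show ?thesis by blast
  qed (auto simp: payoff_def)
  then obtain m where m: "\<And>t. t \<notin> {m} \<Longrightarrow> payoff (\<omega> t) = 0" by auto
  show "summable (\<lambda>t. payoff (\<omega> t))" by (rule summable_finite[of "{m}"]) (use m in auto)
  have "(\<Sum>t. payoff (\<omega> t)) = (\<Sum>t\<in>{m}. payoff (\<omega> t))" by (rule suminf_finite) (use m in auto)
  then show "(\<Sum>t. payoff (\<omega> t)) \<le> 1" by (simp add: payoff_def)
qed

lemma step_after_capture:
  "C1_capture (last h) \<or> last h = Terminal \<Longrightarrow> step \<sigma>3 \<sigma>1 \<sigma>2 h = return_pmf Terminal"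
  by (auto simp: step_def transition_after_capture)

locale scpr_play = scpr G \<sigma>3 for G :: "('a, 'b) pre_digraph" and \<sigma>3 +
  fixes \<sigma>1 \<sigma>2 :: "'a strategy" and s0 :: "'a state"
  assumes C1: "\<sigma>1 \<in> C1_strategies G" and C2: "\<sigma>2 \<in> C2_strategies G" and s0: "s0 \<in> states G"
begin

abbreviation "M \<equiv> \<lambda>_::nat. count_space (states G)"
abbreviation "play \<equiv> play_measure G \<sigma>3 \<sigma>1 \<sigma>2 s0"

sublocale IT: Ionescu_Tulcea "play_kernel G \<sigma>3 \<sigma>1 \<sigma>2 s0" M
  by (rule Ionescu_Tulcea_play_kernel[OF wf finite_verts robber C1 C2 s0])

text \<open>This is the kernel before its restriction to \<open>states G\<close>; remaining a pmf,
  it is accessible to the calculus of discrete expectations.\<close>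

definition next_pmf :: "nat \<Rightarrow> (nat \<Rightarrow> 'a state) \<Rightarrow> 'a state pmf" where
  "next_pmf n \<omega> = (if n = 0 then return_pmf s0 else step \<sigma>3 \<sigma>1 \<sigma>2 (map \<omega> [0..<n]))"

lemma play_eq: "play = IT.PF.lim"
  by (simp add: play_measure_def)

lemma space_play: "space play = UNIV \<rightarrow>\<^sub>E states G"
  by (simp add: play_eq space_PiM)

text \<open>A finite product of finite discrete spaces is discrete, so every function of a finite
  prefix is measurable.\<close>

lemma PiM_eq: "PiM {0..<n} M = count_space (PiE {0..<n} (\<lambda>_. states G))"
  by (rule count_space_PiM_finite) (simp_all add: countable_finite)

lemma measurable_prefix [measurable]: "f \<in> borel_measurable (PiM {0..<n} M)"
  for f :: "_ \<Rightarrow> ennreal"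
  by (simp add: PiM_eq)

lemma measurable_restrict_prefix [measurable]: "(\<lambda>\<omega>. restrict \<omega> {0..<n}) \<in> play \<rightarrow>\<^sub>M PiM {0..<n} M"
  unfolding play_eq measurable_cong_sets[OF IT.PF.sets_lim refl] by (rule measurable_restrict_subset) simp

lemma measurable_play_component [measurable]: "(\<lambda>\<omega>. \<omega> n) \<in> play \<rightarrow>\<^sub>M count_space (states G)"
  unfolding play_eq measurable_cong_sets[OF IT.PF.sets_lim refl] by measurable

section \<open>Integration over plays by conditioning on prefixes\<close>

lemma prob_space_play: "prob_space play"
proof -
  \<comment> \<open>The whole space is the cylinder over the empty index set, so its mass is that of
    a finite-dimensional marginal.\<close>
  have "emeasure play (space play) = emeasure IT.PF.lim (IT.PF.emb UNIV {} (space (PiM {} M)))"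
    by (simp add: play_eq prod_emb_def space_PiM restrict_def)
  also have "\<dots> = emeasure (IT.CI {}) (space (PiM {} M))"
    by (rule IT.lim) auto
  also have "\<dots> = 1"
    using prob_space.emeasure_space_1[OF IT.PF.prob_space_P[of "{}"]]
    by (simp add: IT.PF.space_P)
  finally show ?thesis by (rule prob_spaceI)
qed

lemma nn_integral_play_prefix:
  fixes F :: "(nat \<Rightarrow> 'a state) \<Rightarrow> ennreal"
  shows "(\<integral>\<^sup>+\<omega>. F (restrict \<omega> {0..<n}) \<partial>play) = (\<integral>\<^sup>+\<omega>. F \<omega> \<partial>IT.C 0 n (\<lambda>_. undefined))"
proof -
  \<comment> \<open>The marginal on an index set is built from the finite-horizon law up to the
    first index beyond that set.\<close>
  have up: "IT.up_to {0..<n} = n"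
    using IT.up_to[of "{0..<n}"] by (intro antisym) (auto simp: IT.up_to_iff)
  have und: "(\<lambda>_. undefined) \<in> space (PiM {0..<0} M)" by (simp add: space_PiM)
  have "(\<integral>\<^sup>+\<omega>. F (restrict \<omega> {0..<n}) \<partial>play) = (\<integral>\<^sup>+\<omega>. F \<omega> \<partial>distr IT.PF.lim (PiM {0..<n} M) (\<lambda>\<omega>. restrict \<omega> {0..<n}))"
    using measurable_restrict_prefix by (subst nn_integral_distr) (simp_all add: play_eq)
  also have "\<dots> = (\<integral>\<^sup>+\<omega>. F \<omega> \<partial>IT.CI {0..<n})"
    by (simp add: IT.distr_lim)
  also have "\<dots> = (\<integral>\<^sup>+\<omega>. F (restrict \<omega> {0..<n}) \<partial>IT.C 0 n (\<lambda>_. undefined))"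
    unfolding IT.CI_def up
    by (subst nn_integral_distr) (simp_all add: measurable_cong_sets[OF IT.sets_C[OF und] refl])
  \<comment> \<open>Points of the finite-horizon space are already undefined outside
    \<open>{0..<n}\<close>, so restricting them changes nothing.\<close>
  also have "\<dots> = (\<integral>\<^sup>+\<omega>. F \<omega> \<partial>IT.C 0 n (\<lambda>_. undefined))"
    by (intro nn_integral_cong) (auto simp: IT.space_C[OF und] space_PiM)
  finally show ?thesis .
qed

text \<open>The extension kernel \<open>IT.eP n\<close> appends state \<open>n\<close>. Its
  restriction to \<open>states G\<close> becomes an indicator, which is 1 on the support of
  \<open>next_pmf\<close>.\<close>

lemma nn_integral_C_Suc:
  fixes F :: "(nat \<Rightarrow> 'a state) \<Rightarrow> ennreal"
  shows "(\<integral>\<^sup>+\<omega>. F \<omega> \<partial>IT.C 0 (Suc n) (\<lambda>_. undefined)) =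
    (\<integral>\<^sup>+\<omega>. \<integral>\<^sup>+s. F (fun_upd \<omega> n s) \<partial>next_pmf n \<omega> \<partial>IT.C 0 n (\<lambda>_. undefined))"
proof -
  have und: "(\<lambda>_. undefined) \<in> space (PiM {0..<0} M)" by (simp add: space_PiM)
  have "(\<integral>\<^sup>+\<omega>. F \<omega> \<partial>IT.C 0 (Suc n) (\<lambda>_. undefined)) =
      (\<integral>\<^sup>+\<omega>. \<integral>\<^sup>+\<omega>'. F \<omega>' \<partial>IT.eP n \<omega> \<partial>IT.C 0 n (\<lambda>_. undefined))"
    using IT.measurable_eP[of n]
    by (simp, subst nn_integral_bind[where B="PiM {0..<Suc n} M"])
       (simp_all add: measurable_cong_sets[OF IT.sets_C[OF und] refl])
  also have "\<dots> = (\<integral>\<^sup>+\<omega>. \<integral>\<^sup>+s. F (fun_upd \<omega> n s) \<partial>next_pmf n \<omega> \<partial>IT.C 0 n (\<lambda>_. undefined))"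
  proof (intro nn_integral_cong)
    fix \<omega> assume "\<omega> \<in> space (IT.C 0 n (\<lambda>_. undefined))"
    then have \<omega>: "\<omega> \<in> space (PiM {0..<n} M)" by (simp add: IT.space_C[OF und])
    have sub: "set_pmf (next_pmf n \<omega>) \<subseteq> states G"
      using \<omega> s0 set_pmf_step_subset[OF wf robber C1 C2, of "map \<omega> [0..<n]"]
      by (auto simp: next_pmf_def space_PiM PiE_iff image_subset_iff)
    have "(\<integral>\<^sup>+\<omega>'. F \<omega>' \<partial>IT.eP n \<omega>) = (\<integral>\<^sup>+s. F (fun_upd \<omega> n s) \<partial>play_kernel G \<sigma>3 \<sigma>1 \<sigma>2 s0 n \<omega>)"
      using \<omega> by (rule IT.nn_integral_eP) simp
    also have "\<dots> = (\<integral>\<^sup>+s. F (fun_upd \<omega> n s) * indicator (states G) s \<partial>next_pmf n \<omega>)"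
      unfolding play_kernel_def next_pmf_def by (subst nn_integral_restrict_space) simp_all
    also have "\<dots> = (\<integral>\<^sup>+s. F (fun_upd \<omega> n s) \<partial>next_pmf n \<omega>)"
      using sub by (intro nn_integral_cong_AE) (auto simp: AE_measure_pmf_iff)
    finally show "(\<integral>\<^sup>+\<omega>'. F \<omega>' \<partial>IT.eP n \<omega>) = (\<integral>\<^sup>+s. F (fun_upd \<omega> n s) \<partial>next_pmf n \<omega>)" .
  qed
  finally show ?thesis .
qed

text \<open>The integral is moved to the finite-horizon law, its last state is split off, and the
  result is moved back. Prefixes appear as lists because strategies read lists.\<close>

lemma nn_integral_play_Suc:
  fixes g :: "'a state list \<Rightarrow> ennreal"
  shows "(\<integral>\<^sup>+\<omega>. g (map \<omega> [0..<Suc n]) \<partial>play) =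
    (\<integral>\<^sup>+\<omega>. \<integral>\<^sup>+s. g (map \<omega> [0..<n] @ [s]) \<partial>next_pmf n \<omega> \<partial>play)"
proof -
  have restr: "map (restrict \<omega> {0..<m}) [0..<m] = map \<omega> [0..<m]" for \<omega> :: "nat \<Rightarrow> 'a state" and m
    by simp
  have upd: "map (fun_upd \<omega> n s) [0..<Suc n] = map \<omega> [0..<n] @ [s]" for \<omega> :: "nat \<Rightarrow> 'a state" and s
    by simp
  have next_restr: "next_pmf n (restrict \<omega> {0..<n}) = next_pmf n \<omega>" for \<omega>
    by (simp add: next_pmf_def restr del: upt_Suc)
  have "(\<integral>\<^sup>+\<omega>. g (map \<omega> [0..<Suc n]) \<partial>play) = (\<integral>\<^sup>+\<omega>. g (map \<omega> [0..<Suc n]) \<partial>IT.C 0 (Suc n) (\<lambda>_. undefined))"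
    using nn_integral_play_prefix[of "\<lambda>\<omega>. g (map \<omega> [0..<Suc n])" "Suc n"] unfolding restr .
  also have "\<dots> = (\<integral>\<^sup>+\<omega>. \<integral>\<^sup>+s. g (map \<omega> [0..<n] @ [s]) \<partial>next_pmf n \<omega> \<partial>IT.C 0 n (\<lambda>_. undefined))"
    unfolding nn_integral_C_Suc upd ..
  also have "\<dots> = (\<integral>\<^sup>+\<omega>. \<integral>\<^sup>+s. g (map \<omega> [0..<n] @ [s]) \<partial>next_pmf n \<omega> \<partial>play)"
    using nn_integral_play_prefix[of "\<lambda>\<omega>. \<integral>\<^sup>+s. g (map \<omega> [0..<n] @ [s]) \<partial>next_pmf n \<omega>" n]
    unfolding restr next_restr by simp
  finally show ?thesis .
qed

lemma nn_integral_play_0: "(\<integral>\<^sup>+\<omega>. f (\<omega> 0) \<partial>play) = (f s0 :: ennreal)"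
  using nn_integral_play_Suc[of "\<lambda>h. f (h ! 0)" 0] prob_space.emeasure_space_1[OF prob_space_play]
  by (simp add: next_pmf_def)

section \<open>Absorption and integrability of the total payoff\<close>

lemma measurable_play_finite_prefix [measurable]:
  "(\<lambda>\<omega>. g (map \<omega> [0..<n])) \<in> borel_measurable play" for g :: "'a state list \<Rightarrow> ennreal"
proof -
  have "map (restrict \<omega> {0..<n}) [0..<n] = map \<omega> [0..<n]" for \<omega> :: "nat \<Rightarrow> 'a state"
    by simp
  with measurable_compose[OF measurable_restrict_prefix measurable_prefix,
      of "\<lambda>\<omega>. g (map \<omega> [0..<n])" n]
  show ?thesis by (simp only:)
qed

lemma measurable_payoff [measurable]: "(\<lambda>\<omega>. payoff (\<omega> t)) \<in> borel_measurable play"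
  by (rule measurable_compose[OF measurable_play_component]) simp

text \<open>For each \<open>n\<close> the one-step law gives leaving \<open>Terminal\<close>, or not
  entering it after a C1-capture, probability 0; countably many null events are then
  combined.\<close>

lemma AE_absorbing:
  "AE \<omega> in play. \<forall>n. C1_capture (\<omega> n) \<or> \<omega> n = Terminal \<longrightarrow> \<omega> (Suc n) = Terminal"
  unfolding AE_all_countable
proof
  fix n
  define bad :: "'a state list \<Rightarrow> ennreal" where
    "bad h = (if (C1_capture (h ! n) \<or> h ! n = Terminal) \<and> h ! Suc n \<noteq> Terminal then 1 else 0)" for h
  have "(\<integral>\<^sup>+s. bad (map \<omega> [0..<Suc n] @ [s]) \<partial>next_pmf (Suc n) \<omega>) = 0" for \<omega>
    by (cases "C1_capture (\<omega> n) \<or> \<omega> n = Terminal")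
       (auto simp: bad_def next_pmf_def step_after_capture nth_append)
  then have "(\<integral>\<^sup>+\<omega>. bad (map \<omega> [0..<Suc (Suc n)]) \<partial>play) = 0"
    unfolding nn_integral_play_Suc by simp
  then have "AE \<omega> in play. bad (map \<omega> [0..<Suc (Suc n)]) = 0"
    by (subst (asm) nn_integral_0_iff_AE[OF measurable_play_finite_prefix])
  then show "AE \<omega> in play. C1_capture (\<omega> n) \<or> \<omega> n = Terminal \<longrightarrow> \<omega> (Suc n) = Terminal"
    by (rule AE_mp) (auto simp: bad_def nth_append split: if_splits)
qed

text \<open>Both the infinite sum and the Bochner integral would take default values without
  convergence. Almost surely the sum exists and lies between 0 and 1, which gives integrability; the
  interchange of sum and nonnegative integral does the rest.\<close>

lemma ennreal_expected_payoff:
  "ennreal (expected_payoff G \<sigma>3 \<sigma>1 \<sigma>2 s0) = (SUP n. \<integral>\<^sup>+\<omega>. ennreal (\<Sum>t<n. payoff (\<omega> t)) \<partial>play)"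
  and expected_payoff_nonneg: "0 \<le> expected_payoff G \<sigma>3 \<sigma>1 \<sigma>2 s0"
proof -
  interpret P: prob_space play by (rule prob_space_play)
  have AE: "AE \<omega> in play. summable (\<lambda>t. payoff (\<omega> t)) \<and> (\<Sum>t. payoff (\<omega> t)) \<le> 1"
    using AE_absorbing by eventually_elim (use sum_payoff_absorbing in blast)
  then have nn: "AE \<omega> in play. 0 \<le> (\<Sum>t. payoff (\<omega> t))"
    by eventually_elim (simp add: suminf_nonneg)
  have int: "integrable play (\<lambda>\<omega>. \<Sum>t. payoff (\<omega> t))"
    by (rule P.integrable_const_bound[where B=1]) (use AE nn in \<open>eventually_elim, simp\<close>, measurable)
  show "0 \<le> expected_payoff G \<sigma>3 \<sigma>1 \<sigma>2 s0"
    unfolding expected_payoff_def by (rule integral_nonneg_AE[OF nn])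
  have "ennreal (expected_payoff G \<sigma>3 \<sigma>1 \<sigma>2 s0) = (\<integral>\<^sup>+\<omega>. ennreal (\<Sum>t. payoff (\<omega> t)) \<partial>play)"
    unfolding expected_payoff_def by (rule nn_integral_eq_integral[OF int nn, symmetric])
  also have "\<dots> = (\<integral>\<^sup>+\<omega>. (\<Sum>t. ennreal (payoff (\<omega> t))) \<partial>play)"
    by (rule nn_integral_cong_AE) (use AE in \<open>eventually_elim, simp add: suminf_ennreal2\<close>)
  also have "\<dots> = (SUP n. \<Sum>t<n. \<integral>\<^sup>+\<omega>. ennreal (payoff (\<omega> t)) \<partial>play)"
    by (subst nn_integral_suminf) (simp_all add: suminf_eq_SUP)
  also have "\<dots> = (SUP n. \<integral>\<^sup>+\<omega>. ennreal (\<Sum>t<n. payoff (\<omega> t)) \<partial>play)"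
    by (simp add: nn_integral_sum[symmetric] sum_ennreal)
  finally show "ennreal (expected_payoff G \<sigma>3 \<sigma>1 \<sigma>2 s0) = \<dots>" .
qed

section \<open>Potentials and bounds on the expected payoff\<close>

definition potential :: "(nat \<Rightarrow> 'a state \<Rightarrow> real) \<Rightarrow> nat \<Rightarrow> ennreal" where
  "potential u n = (\<integral>\<^sup>+\<omega>. ennreal ((\<Sum>t<n. payoff (\<omega> t)) + u n (\<omega> n)) \<partial>play)"

lemma potential_0: "potential u 0 = ennreal (u 0 s0)"
  using nn_integral_play_0[of "\<lambda>s. ennreal (u 0 s)"] by (simp add: potential_def)

lemma set_prefix_subset: "\<omega> \<in> space play \<Longrightarrow> set (map \<omega> [0..<n]) \<subseteq> states G"
  by (auto simp: space_play)

text \<open>Conditioning on the states up to time \<open>n\<close> leaves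
  \<open>payoff (\<omega> n)\<close> known. It is grouped with the conditional expectation so that
  the two together compare with \<open>u n (\<omega> n)\<close>. The estimate \<open>u\<close> is
  indexed by time to cover both \<open>limit_value\<close> and the truncated game.\<close>

lemma potential_Suc:
  assumes nonneg: "\<forall>s\<in>states G. 0 \<le> u (Suc n) s"
  shows "potential u (Suc n) = (\<integral>\<^sup>+\<omega>. ennreal ((\<Sum>t<n. payoff (\<omega> t)) + (payoff (\<omega> n) +
    measure_pmf.expectation (step \<sigma>3 \<sigma>1 \<sigma>2 (map \<omega> [0..<Suc n])) (u (Suc n)))) \<partial>play)"
proof -
  have "potential u (Suc n) = (\<integral>\<^sup>+\<omega>. ennreal ((\<Sum>t<Suc n. payoff (map \<omega> [0..<Suc (Suc n)] ! t)) +
      u (Suc n) (map \<omega> [0..<Suc (Suc n)] ! Suc n)) \<partial>play)"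
    unfolding potential_def
    by (intro nn_integral_cong arg_cong[where f=ennreal] arg_cong2[where f="(+)"] sum.cong)
       (simp_all del: upt_Suc)
  also have "\<dots> = (\<integral>\<^sup>+\<omega>. \<integral>\<^sup>+s. ennreal ((\<Sum>t<Suc n. payoff ((map \<omega> [0..<Suc n] @ [s]) ! t)) +
      u (Suc n) ((map \<omega> [0..<Suc n] @ [s]) ! Suc n)) \<partial>next_pmf (Suc n) \<omega> \<partial>play)"
    by (rule nn_integral_play_Suc)
  also have "\<dots> = (\<integral>\<^sup>+\<omega>. \<integral>\<^sup>+s. ennreal ((\<Sum>t<Suc n. payoff (\<omega> t)) + u (Suc n) s)
      \<partial>step \<sigma>3 \<sigma>1 \<sigma>2 (map \<omega> [0..<Suc n]) \<partial>play)"
    unfolding next_pmf_def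
    by (intro nn_integral_cong arg_cong2[where f=nn_integral] arg_cong[where f=ennreal]
        arg_cong2[where f="(+)"] sum.cong ext) (simp_all add: nth_append del: upt_Suc)
  also have "\<dots> = (\<integral>\<^sup>+\<omega>. ennreal ((\<Sum>t<n. payoff (\<omega> t)) + (payoff (\<omega> n) +
    measure_pmf.expectation (step \<sigma>3 \<sigma>1 \<sigma>2 (map \<omega> [0..<Suc n])) (u (Suc n)))) \<partial>play)"
  proof (intro nn_integral_cong)
    fix \<omega> assume \<omega>: "\<omega> \<in> space play"
    let ?p = "step \<sigma>3 \<sigma>1 \<sigma>2 (map \<omega> [0..<Suc n])" and ?c = "\<Sum>t<Suc n. payoff (\<omega> t)"
    have sub: "set_pmf ?p \<subseteq> states G"
      by (rule set_pmf_step_subset[OF wf robber C1 C2 _ set_prefix_subset[OF \<omega>]]) simp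
    then have fin: "finite (set_pmf ?p)" by (rule finite_subset) simp
    have int: "integrable ?p f" for f :: "'a state \<Rightarrow> real"
      by (rule integrable_measure_pmf_finite[OF fin])
    have "(\<integral>\<^sup>+s. ennreal (?c + u (Suc n) s) \<partial>?p) = ennreal (\<integral>s. ?c + u (Suc n) s \<partial>?p)"
      using sub nonneg by (intro nn_integral_eq_integral int) (auto simp: AE_measure_pmf_iff intro!: add_nonneg_nonneg sum_nonneg)
    also have "(\<integral>s. ?c + u (Suc n) s \<partial>?p) = ?c + measure_pmf.expectation ?p (u (Suc n))"
      by (subst Bochner_Integration.integral_add[OF int int]) simp
    finally show "(\<integral>\<^sup>+s. ennreal (?c + u (Suc n) s) \<partial>?p) = ennreal ((\<Sum>t<n. payoff (\<omega> t)) + (payoff (\<omega> n) +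
        measure_pmf.expectation ?p (u (Suc n))))"
      by (simp add: add.assoc)
  qed
  finally show ?thesis .
qed

text \<open>A history of length \<open>Suc n\<close> ends in the state of time \<open>n\<close>,
  which is where \<open>u n\<close> is evaluated.\<close>

lemma potential_decreasing:
  assumes "\<forall>s\<in>states G. 0 \<le> u (Suc n) s"
    and "\<And>h. length h = Suc n \<Longrightarrow> set h \<subseteq> states G \<Longrightarrow>
      payoff (last h) + measure_pmf.expectation (step \<sigma>3 \<sigma>1 \<sigma>2 h) (u (Suc n)) \<le> u n (last h)"
  shows "potential u (Suc n) \<le> potential u n"
  unfolding potential_Suc[of u n, OF assms(1)] unfolding potential_def
proof (intro nn_integral_mono ennreal_leI add_left_mono)
  fix \<omega> assume "\<omega> \<in> space play"
  from assms(2)[OF _ set_prefix_subset[OF this], of "Suc n"]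
  show "payoff (\<omega> n) + measure_pmf.expectation (step \<sigma>3 \<sigma>1 \<sigma>2 (map \<omega> [0..<Suc n])) (u (Suc n)) \<le> u n (\<omega> n)"
    by simp
qed

lemma potential_increasing:
  assumes "\<forall>s\<in>states G. 0 \<le> u (Suc n) s"
    and "\<And>h. length h = Suc n \<Longrightarrow> set h \<subseteq> states G \<Longrightarrow>
      u n (last h) \<le> payoff (last h) + measure_pmf.expectation (step \<sigma>3 \<sigma>1 \<sigma>2 h) (u (Suc n))"
  shows "potential u n \<le> potential u (Suc n)"
  unfolding potential_Suc[of u n, OF assms(1)] unfolding potential_def
proof (intro nn_integral_mono ennreal_leI add_left_mono)
  fix \<omega> assume "\<omega> \<in> space play"
  from assms(2)[OF _ set_prefix_subset[OF this], of "Suc n"]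
  show "u n (\<omega> n) \<le> payoff (\<omega> n) + measure_pmf.expectation (step \<sigma>3 \<sigma>1 \<sigma>2 (map \<omega> [0..<Suc n])) (u (Suc n))"
    by simp
qed

text \<open>The potential starts at \<open>u s0\<close> and never grows; dropping its nonnegative
  last term bounds every partial sum of payoffs.\<close>

lemma expected_payoff_le:
  assumes nonneg: "\<And>s. s \<in> states G \<Longrightarrow> 0 \<le> u s"
    and step: "\<And>h. h \<noteq> [] \<Longrightarrow> set h \<subseteq> states G \<Longrightarrow>
      payoff (last h) + measure_pmf.expectation (step \<sigma>3 \<sigma>1 \<sigma>2 h) u \<le> u (last h)"
  shows "expected_payoff G \<sigma>3 \<sigma>1 \<sigma>2 s0 \<le> u s0"
proof -
  have pot: "potential (\<lambda>_. u) n \<le> ennreal (u s0)" for n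
  proof (induction n)
    case (Suc n)
    have "potential (\<lambda>_. u) (Suc n) \<le> potential (\<lambda>_. u) n"
    proof (rule potential_decreasing)
      show "payoff (last h) + measure_pmf.expectation (step \<sigma>3 \<sigma>1 \<sigma>2 h) u \<le> u (last h)"
        if "length h = Suc n" "set h \<subseteq> states G" for h
        using that by (intro step) auto
    qed (use nonneg in blast)
    then show ?case using Suc.IH by simp
  qed (simp add: potential_0)
  have "(\<integral>\<^sup>+\<omega>. ennreal (\<Sum>t<n. payoff (\<omega> t)) \<partial>play) \<le> potential (\<lambda>_. u) n" for n
    unfolding potential_def using nonneg
    by (intro nn_integral_mono ennreal_leI) (auto simp: space_play PiE_iff)
  then have "ennreal (expected_payoff G \<sigma>3 \<sigma>1 \<sigma>2 s0) \<le> ennreal (u s0)"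
    unfolding ennreal_expected_payoff using pot by (intro SUP_least) (rule order_trans)
  then show ?thesis using nonneg[OF s0] by simp
qed

text \<open>The potential starts at \<open>u 0 s0\<close> and does not fall up to time
  \<open>N\<close>, where it has become a partial sum of payoffs, which the expected payoff
  dominates.\<close>

lemma expected_payoff_ge:
  assumes nonneg: "\<And>n s. s \<in> states G \<Longrightarrow> 0 \<le> u n s"
    and step: "\<And>h n. n < N \<Longrightarrow> length h = Suc n \<Longrightarrow> set h \<subseteq> states G \<Longrightarrow>
      u n (last h) \<le> payoff (last h) + measure_pmf.expectation (step \<sigma>3 \<sigma>1 \<sigma>2 h) (u (Suc n))"
    and final: "u N = payoff"
  shows "u 0 s0 \<le> expected_payoff G \<sigma>3 \<sigma>1 \<sigma>2 s0"
proof -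
  have "n \<le> N \<Longrightarrow> ennreal (u 0 s0) \<le> potential u n" for n
  proof (induction n)
    case (Suc n)
    have "potential u n \<le> potential u (Suc n)"
      using nonneg step[of n] Suc.prems by (intro potential_increasing) auto
    then show ?case using Suc by simp
  qed (simp add: potential_0)
  then have "ennreal (u 0 s0) \<le> potential u N" by simp
  \<comment> \<open>The final estimate \<open>payoff (\<omega> N)\<close> is the missing term of
    index \<open>N\<close>, hence the bound \<open>Suc N\<close>.\<close>
  also have "\<dots> = (\<integral>\<^sup>+\<omega>. ennreal (\<Sum>t<Suc N. payoff (\<omega> t)) \<partial>play)"
    by (simp add: potential_def final)
  also have "\<dots> \<le> ennreal (expected_payoff G \<sigma>3 \<sigma>1 \<sigma>2 s0)"
    unfolding ennreal_expected_payoff by (intro SUP_upper) simp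
  finally show ?thesis using expected_payoff_nonneg by simp
qed

end

section \<open>The value of the game\<close>

context scpr
begin

lemma SCPR_has_value_limit_value:
  assumes s: "s \<in> states G"
  shows "SCPR_has_value G \<sigma>3 s (limit_value s)"
  unfolding SCPR_has_value_def
proof -
  obtain \<sigma>2 where C2: "\<sigma>2 \<in> C2_strategies G"
    and opt2: "\<And>\<sigma>1 h. \<sigma>1 \<in> C1_strategies G \<Longrightarrow> h \<noteq> [] \<Longrightarrow> set h \<subseteq> states G \<Longrightarrow>
      payoff (last h) + measure_pmf.expectation (step \<sigma>3 \<sigma>1 \<sigma>2 h) limit_value \<le> shapley limit_value (last h)"
    using optimal_C2_strategy[of limit_value] by auto
  show "has_value (C1_strategies G) (C2_strategies G) (\<lambda>\<sigma>1 \<sigma>2. expected_payoff G \<sigma>3 \<sigma>1 \<sigma>2 s) (limit_value s)"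
  proof (rule has_valueI[OF _ C2])
    fix \<sigma>1 assume C1: "\<sigma>1 \<in> C1_strategies G"
    interpret scpr_play G \<sigma>3 \<sigma>1 \<sigma>2 s by unfold_locales (fact C1 C2 s)+
    \<comment> \<open>The fixed-point equation turns \<open>opt2\<close> into the one-step
      inequality for the constant estimate \<open>limit_value\<close>.\<close>
    show "expected_payoff G \<sigma>3 \<sigma>1 \<sigma>2 s \<le> limit_value s"
      using opt2[OF C1] shapley_limit_value last_in_states
      by (intro expected_payoff_le limit_value_nonneg) fastforce+
  next
    fix c assume "c < limit_value s"
    then obtain N where N: "c < value_iter G \<sigma>3 N s"
      using order_tendstoD(1)[OF value_iter_tendsto(1)[OF s]] by (auto simp: eventually_sequentially)
    \<comment> \<open>At time \<open>n\<close> the history has length \<open>n + 1\<close>, so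
      \<open>N - length h\<close> is the horizon left after the current step. Beyond time
      \<open>N\<close> it stays 0 by truncated subtraction, and the choices made there do not affect
      the bound.\<close>
    obtain \<sigma>1 where C1: "\<sigma>1 \<in> C1_strategies G"
      and opt1: "\<And>\<sigma>2 h. \<sigma>2 \<in> C2_strategies G \<Longrightarrow> h \<noteq> [] \<Longrightarrow> set h \<subseteq> states G \<Longrightarrow>
        shapley (value_iter G \<sigma>3 (N - length h)) (last h) \<le>
          payoff (last h) + measure_pmf.expectation (step \<sigma>3 \<sigma>1 \<sigma>2 h) (value_iter G \<sigma>3 (N - length h))"
      using optimal_C1_strategy[of "\<lambda>h. value_iter G \<sigma>3 (N - length h)"] by auto
    have "value_iter G \<sigma>3 N s \<le> expected_payoff G \<sigma>3 \<sigma>1 \<sigma>2 s" if C2: "\<sigma>2 \<in> C2_strategies G" for \<sigma>2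
    proof -
      interpret scpr_play G \<sigma>3 \<sigma>1 \<sigma>2 s by unfold_locales (fact C1 C2 s)+
      show ?thesis
      proof (rule expected_payoff_ge[of "\<lambda>n. value_iter G \<sigma>3 (N - n)" N, simplified])
        fix h n assume h: "n < N" "length h = Suc n" "set h \<subseteq> states G"
        \<comment> \<open>Before time \<open>N\<close> the subtraction is genuine, so the operator
          applied to the next estimate is the current one.\<close>
        then have "N - n = Suc (N - Suc n)" by simp
        then show "value_iter G \<sigma>3 (N - n) (last h) \<le>
            payoff (last h) + measure_pmf.expectation (step \<sigma>3 \<sigma>1 \<sigma>2 h) (value_iter G \<sigma>3 (N - Suc n))"
          using opt1[OF C2, of h] h by (simp only: value_iter_Suc) force
      qed (auto simp: value_iter_nonneg value_iter_0 simp del: value_iter.simps)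
    qed
    then show "\<exists>\<sigma>1\<in>C1_strategies G. \<forall>\<sigma>2\<in>C2_strategies G. c \<le> expected_payoff G \<sigma>3 \<sigma>1 \<sigma>2 s"
      using C1 N by (intro bexI[of _ \<sigma>1]) fastforce+
  qed
qed

end

theorem theorem4:
  fixes G :: "('a, 'b) pre_digraph" and \<sigma>3 :: "'a state \<Rightarrow> 'a pmf"
  assumes "graph G" and "Digraph_Component.connected G"
    and "robber_strategy G \<sigma>3"
  shows "\<forall>s\<in>active_states G. \<exists>w. SCPR_has_value G \<sigma>3 s w \<and> (\<lambda>i. value_iter G \<sigma>3 i s) \<longlonglongrightarrow> w"
proof
  fix s assume s: "s \<in> active_states G"
  interpret graph G by fact
  interpret scpr G \<sigma>3
    using assms(3) by unfold_locales auto
  have "s \<in> states G" using s by (simp add: states_def)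
  then show "\<exists>w. SCPR_has_value G \<sigma>3 s w \<and> (\<lambda>i. value_iter G \<sigma>3 i s) \<longlonglongrightarrow> w"
    using SCPR_has_value_limit_value value_iter_tendsto(1) by blast
qed

end
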